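(* Let $\mathfrak{G}$ be a shift-invariant groupoid with unit space $\mathcal{F}\subset\mathsf{X}^\omega$. The following conditions are equivalent. (1) There exists a compact set $C\subset\mathfrak{G}$ such that for every $g\in\mathfrak{G}$ there exists $n$ such that $\varsigma^n(g)\in C$. (2) There exists a compact open subset $N\subset\mathfrak{G}$ satisfying condition (1) (i.e., for every $g\in\mathfrak{G}$ there exists $n$ with $\varsigma^n(g)\in N$) and such that $\varsigma(N)=N$. (3) There exists a finite set $\mathcal{N}$ of compact open $\mathfrak{G}$-bisections, containing the empty one, such that for every compact open $\mathfrak{G}$-bisection $F$ there exists $n$ such that for all $m\ge n$ and all $v_1,v_2\in\mathsf{X}^m$ the partial homeomorphism $S_{v_1}^{-1}FS_{v_2}$ belongs to $\mathcal{N}$. Moreover, the set $N$ in condition (2) is unique, and there exists a smallest set $\mathcal{N}$ satisfying condition (3).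
   Context: Groupoid conventions. For an element $g$ of a groupoid, $\mathsf{s}(g)=g^{-1}g$, $\mathsf{r}(g)=gg^{-1}$; the product $g_1g_2$ is defined iff $\mathsf{s}(g_1)=\mathsf{r}(g_2)$. Topological groupoids are locally compact with Hausdorff unit space (the groupoid itself need not be Hausdorff); étale means $\mathsf{s},\mathsf{r}$ are local homeomorphisms; a bisection is a subset $U$ on which $\mathsf{s}\colon U\to\mathsf{s}(U)$ and $\mathsf{r}\colon U\to\mathsf{r}(U)$ are homeomorphisms. Ample groupoids (étale with totally disconnected unit space) are assumed second countable. An étale groupoid is effective if every neighborhood of every non-unit $g$ contains $h$ with $\mathsf{s}(h)\ne\mathsf{r}(h)$; equivalently it is the groupoid of germs of the local homeomorphisms $\mathsf{s}(g)\mapsto\mathsf{r}(g)$, $g\in F$, for open bisections $F$; open bisections are identified with these local homeomorphisms. Shifts. $\mathsf{X}$ is a finite alphabet and $\mathcal{F}\subset\mathsf{X}^\omega$ is a one-sided topological Markov chain: the set of all sequences $x_1x_2\ldots$ with $x_nx_{n+1}\in T$ for all $n$, for a fixed $T\subset\mathsf{X}^2$; $\sigma(x_1x_2\ldots)=x_2x_3\ldots$. For $x\in\mathsf{X}$, $S_x$ is the local homeomorphism $w\mapsto xw$ defined on $\{w\in\mathcal{F}:xw\in\mathcal{F}\}$; $S_{x_1\ldots x_n}=S_{x_1}\cdots S_{x_n}$ (possibly the empty map). Shift-invariance. Let $\mathfrak{G}$ be an effective étale groupoid with unit space $\mathcal{F}$. For $g\in\mathfrak{G}$ with $\mathsf{s}(g)=x_1x_2\ldots$,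 $\mathsf{r}(g)=y_1y_2\ldots$, let $\varsigma(g)=\sigma g\sigma^{-1}$ be the germ of $S_{y_1}^{-1}FS_{x_1}$ at $x_2x_3\ldots$, where $F$ is an open bisection containing $g$. $\mathfrak{G}$ is called shift-invariant if $\varsigma(\mathfrak{G})\subset\mathfrak{G}$. *)

theory Defs
  imports "HOL-Analysis.Analysis"
begin

section \<open>One-sided topological Markov chains\<close>

definition markov_chain :: "'a set \<Rightarrow> ('a \<times> 'a) set \<Rightarrow> (nat \<Rightarrow> 'a) set" where
  "markov_chain X T = {w. (\<forall>n. w n \<in> X) \<and> (\<forall>n. (w n, w (Suc n)) \<in> T)}"

definition markov_space :: "'a set \<Rightarrow> ('a \<times> 'a) set \<Rightarrow> (nat \<Rightarrow> 'a) topology" where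
  "markov_space X T =
     subtopology (product_topology (\<lambda>_. discrete_topology X) UNIV) (markov_chain X T)"

definition shift :: "(nat \<Rightarrow> 'a) \<Rightarrow> nat \<Rightarrow> 'a" where
  "shift w = (\<lambda>n. w (Suc n))"

text \<open>
  Partial maps between sequences are represented by their graphs. Relational composition is written
  in diagrammatic order: \<open>f O g\<close> is ``first \<open>f\<close>, then \<open>g\<close>''. In what follows \<open>E\<close> is the
  space of sequences; \<open>case_nat x w\<close> is the sequence \<open>x\<close> followed by \<open>w\<close>.
\<close>

definition S_letter :: "(nat \<Rightarrow> 'a) topology \<Rightarrow> 'a \<Rightarrow> (nat \<Rightarrow> 'a) rel" where
  "S_letter E x = {(w, case_nat x w) | w. w \<in> topspace E \<and> case_nat x w \<in> topspace E}"

primrec S_word :: "(nat \<Rightarrow> 'a) topology \<Rightarrow> 'a list \<Rightarrow> (nat \<Rightarrow> 'a) rel" where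
  "S_word E [] = Id_on (topspace E)"
| "S_word E (x # v) = S_word E v O S_letter E x"

definition words :: "'a set \<Rightarrow> nat \<Rightarrow> 'a list set" where
  "words X m = {v. set v \<subseteq> X \<and> length v = m}"

text \<open>The germ of \<open>f\<close> at \<open>x\<close>: the point, and all \<open>f'\<close> agreeing with \<open>f\<close> near the point.\<close>

definition germ :: "'b topology \<Rightarrow> 'b rel \<Rightarrow> 'b \<Rightarrow> 'b \<times> 'b rel set" where
  "germ E f x =
     (x, {f'. \<exists>W. openin E W \<and> x \<in> W \<and> f' \<inter> (W \<times> UNIV) = f \<inter> (W \<times> UNIV)})"


section \<open>Topological groupoids\<close>

definition second_countable_space :: "'b topology \<Rightarrow> bool" where
  "second_countable_space Y \<longleftrightarrow>
     (\<exists>\<B>. countable \<B> \<and> (\<forall>V\<in>\<B>. openin Y V) \<and>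
          (\<forall>U y. openin Y U \<and> y \<in> U \<longrightarrow> (\<exists>V\<in>\<B>. y \<in> V \<and> V \<subseteq> U)))"

definition local_homeomorphism_map :: "'b topology \<Rightarrow> 'c topology \<Rightarrow> ('b \<Rightarrow> 'c) \<Rightarrow> bool" where
  "local_homeomorphism_map Y Z f \<longleftrightarrow>
     (\<forall>y\<in>topspace Y. \<exists>U V. openin Y U \<and> y \<in> U \<and> openin Z V \<and>
        homeomorphic_map (subtopology Y U) (subtopology Z V) f)"

text \<open>
  The set of elements is \<open>topspace (gtop G)\<close>; \<open>gmult G g h\<close> is meaningful only if
  \<open>src G g = rng G h\<close>.
\<close>

record 'g groupoid_data =
  gtop :: "'g topology"
  gmult :: "'g \<Rightarrow> 'g \<Rightarrow> 'g"
  ginv :: "'g \<Rightarrow> 'g"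

abbreviation elems :: "'g groupoid_data \<Rightarrow> 'g set" where
  "elems G \<equiv> topspace (gtop G)"

definition src :: "'g groupoid_data \<Rightarrow> 'g \<Rightarrow> 'g" where
  "src G g = gmult G (ginv G g) g"

definition rng :: "'g groupoid_data \<Rightarrow> 'g \<Rightarrow> 'g" where
  "rng G g = gmult G g (ginv G g)"

definition units :: "'g groupoid_data \<Rightarrow> 'g set" where
  "units G = src G ` elems G"

abbreviation unit_top :: "'g groupoid_data \<Rightarrow> 'g topology" where
  "unit_top G \<equiv> subtopology (gtop G) (units G)"

definition composable :: "'g groupoid_data \<Rightarrow> ('g \<times> 'g) set" where
  "composable G = {(g, h). g \<in> elems G \<and> h \<in> elems G \<and> src G g = rng G h}"

locale groupoid =
  fixes G :: "'g groupoid_data"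
  assumes inv_closed: "g \<in> elems G \<Longrightarrow> ginv G g \<in> elems G"
    and inv_inv: "g \<in> elems G \<Longrightarrow> ginv G (ginv G g) = g"
    and mult_closed: "(g, h) \<in> composable G \<Longrightarrow> gmult G g h \<in> elems G"
    and src_mult: "(g, h) \<in> composable G \<Longrightarrow> src G (gmult G g h) = src G h"
    and rng_mult: "(g, h) \<in> composable G \<Longrightarrow> rng G (gmult G g h) = rng G g"
    and mult_assoc: "(g, h) \<in> composable G \<Longrightarrow> (h, k) \<in> composable G \<Longrightarrow>
           gmult G (gmult G g h) k = gmult G g (gmult G h k)"
    and inv_mult_cancel: "(g, h) \<in> composable G \<Longrightarrow> gmult G (ginv G g) (gmult G g h) = h"
    and mult_inv_cancel: "(g, h) \<in> composable G \<Longrightarrow> gmult G (gmult G g h) (ginv G h) = g"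

text \<open>Only the unit space is required to be Hausdorff.\<close>

locale topological_groupoid = groupoid G for G :: "'g groupoid_data" +
  assumes continuous_mult:
      "continuous_map (subtopology (prod_topology (gtop G) (gtop G)) (composable G)) (gtop G)
         (\<lambda>(g, h). gmult G g h)"
    and continuous_inv: "continuous_map (gtop G) (gtop G) (ginv G)"
    and locally_compact: "locally_compact_space (gtop G)"
    and Hausdorff_units: "Hausdorff_space (unit_top G)"

locale etale_groupoid = topological_groupoid G for G :: "'g groupoid_data" +
  assumes src_local_homeomorphism: "local_homeomorphism_map (gtop G) (unit_top G) (src G)"
    and rng_local_homeomorphism: "local_homeomorphism_map (gtop G) (unit_top G) (rng G)"

definition bisection :: "'g groupoid_data \<Rightarrow> 'g set \<Rightarrow> bool" where
  "bisection G U \<longleftrightarrow> U \<subseteq> elems G \<and>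
     homeomorphic_map (subtopology (gtop G) U) (subtopology (gtop G) (src G ` U)) (src G) \<and>
     homeomorphic_map (subtopology (gtop G) U) (subtopology (gtop G) (rng G ` U)) (rng G)"

definition open_bisection :: "'g groupoid_data \<Rightarrow> 'g set \<Rightarrow> bool" where
  "open_bisection G U \<longleftrightarrow> openin (gtop G) U \<and> bisection G U"

definition compact_open_bisection :: "'g groupoid_data \<Rightarrow> 'g set \<Rightarrow> bool" where
  "compact_open_bisection G U \<longleftrightarrow> compactin (gtop G) U \<and> openin (gtop G) U \<and> bisection G U"

definition effective :: "'g groupoid_data \<Rightarrow> bool" where
  "effective G \<longleftrightarrow>
     (\<forall>g \<in> elems G - units G. \<forall>U. openin (gtop G) U \<and> g \<in> U \<longrightarrow> (\<exists>h\<in>U. src G h \<noteq> rng G h))"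


section \<open>Groupoids over a space of sequences\<close>

text \<open>
  In this section \<open>e\<close> is a homeomorphism from the unit space of \<open>G\<close> onto \<open>E\<close>, by which the two
  spaces are identified.
\<close>

definition src_seq :: "'g groupoid_data \<Rightarrow> ('g \<Rightarrow> nat \<Rightarrow> 'a) \<Rightarrow> 'g \<Rightarrow> nat \<Rightarrow> 'a" where
  "src_seq G e g = e (src G g)"

definition rng_seq :: "'g groupoid_data \<Rightarrow> ('g \<Rightarrow> nat \<Rightarrow> 'a) \<Rightarrow> 'g \<Rightarrow> nat \<Rightarrow> 'a" where
  "rng_seq G e g = e (rng G g)"

text \<open>The partial homeomorphism of \<open>E\<close> with which an open bisection is identified.\<close>

definition bis_map :: "'g groupoid_data \<Rightarrow> ('g \<Rightarrow> nat \<Rightarrow> 'a) \<Rightarrow> 'g set \<Rightarrow> (nat \<Rightarrow> 'a) rel" where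
  "bis_map G e U = {(src_seq G e h, rng_seq G e h) | h. h \<in> U}"

text \<open>
  In the next two definitions the choice of the open bisection containing \<open>g\<close> does not matter, since
  any two of them agree on their intersection, which is an open neighbourhood of \<open>g\<close>.
\<close>

definition bis_at :: "'g groupoid_data \<Rightarrow> 'g \<Rightarrow> 'g set" where
  "bis_at G g = (SOME U. open_bisection G U \<and> g \<in> U)"

definition elem_germ ::
  "(nat \<Rightarrow> 'a) topology \<Rightarrow> 'g groupoid_data \<Rightarrow> ('g \<Rightarrow> nat \<Rightarrow> 'a) \<Rightarrow> 'g
     \<Rightarrow> (nat \<Rightarrow> 'a) \<times> (nat \<Rightarrow> 'a) rel set" where
  "elem_germ E G e g = germ E (bis_map G e (bis_at G g)) (src_seq G e g)"

text \<open>The germ of \<open>S\<^sub>y\<^sup>-\<^sup>1 F S\<^sub>x\<close>, where \<open>x\<close> and \<open>y\<close> are the first letters of source and range.\<close>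

definition shifted_germ ::
  "(nat \<Rightarrow> 'a) topology \<Rightarrow> 'g groupoid_data \<Rightarrow> ('g \<Rightarrow> nat \<Rightarrow> 'a) \<Rightarrow> 'g
     \<Rightarrow> (nat \<Rightarrow> 'a) \<times> (nat \<Rightarrow> 'a) rel set" where
  "shifted_germ E G e g =
     germ E (S_letter E (src_seq G e g 0) O bis_map G e (bis_at G g) O
             converse (S_letter E (rng_seq G e g 0)))
       (shift (src_seq G e g))"

text \<open>
  The inclusion of \<open>\<sigma> G \<sigma>\<^sup>-\<^sup>1\<close> in \<open>G\<close> is taken inside the groupoid of all germs of partial
  homeomorphisms of \<open>E\<close>, into which an effective \<open>G\<close> embeds by \<open>elem_germ\<close>.
\<close>

locale shift_invariant_groupoid = etale_groupoid G
  for E :: "(nat \<Rightarrow> 'a) topology" and G :: "'g groupoid_data" and e :: "'g \<Rightarrow> nat \<Rightarrow> 'a" +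
  assumes second_countable: "second_countable_space (gtop G)"
    and effective: "effective G"
    and unit_space: "homeomorphic_map (unit_top G) E e"
    and shift_invariant: "shifted_germ E G e ` elems G \<subseteq> elem_germ E G e ` elems G"

definition varsigma ::
  "(nat \<Rightarrow> 'a) topology \<Rightarrow> 'g groupoid_data \<Rightarrow> ('g \<Rightarrow> nat \<Rightarrow> 'a) \<Rightarrow> 'g \<Rightarrow> 'g" where
  "varsigma E G e g = (THE h. h \<in> elems G \<and> elem_germ E G e h = shifted_germ E G e g)"


section \<open>Contraction conditions\<close>

definition absorbing ::
  "(nat \<Rightarrow> 'a) topology \<Rightarrow> 'g groupoid_data \<Rightarrow> ('g \<Rightarrow> nat \<Rightarrow> 'a) \<Rightarrow> 'g set \<Rightarrow> bool" where
  "absorbing E G e C \<longleftrightarrow> (\<forall>g\<in>elems G. \<exists>n. (varsigma E G e ^^ n) g \<in> C)"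

definition is_nucleus ::
  "(nat \<Rightarrow> 'a) topology \<Rightarrow> 'g groupoid_data \<Rightarrow> ('g \<Rightarrow> nat \<Rightarrow> 'a) \<Rightarrow> 'g set \<Rightarrow> bool" where
  "is_nucleus E G e N \<longleftrightarrow>
     compactin (gtop G) N \<and> openin (gtop G) N \<and> absorbing E G e N \<and> varsigma E G e ` N = N"

definition is_bisection_nucleus ::
  "'a set \<Rightarrow> (nat \<Rightarrow> 'a) topology \<Rightarrow> 'g groupoid_data \<Rightarrow> ('g \<Rightarrow> nat \<Rightarrow> 'a) \<Rightarrow> 'g set set \<Rightarrow> bool"
  where
  "is_bisection_nucleus X E G e \<N> \<longleftrightarrow>
     finite \<N> \<and> (\<forall>H\<in>\<N>. compact_open_bisection G H) \<and> {} \<in> \<N> \<and>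
     (\<forall>F. compact_open_bisection G F \<longrightarrow>
        (\<exists>n. \<forall>m\<ge>n. \<forall>v1\<in>words X m. \<forall>v2\<in>words X m.
           S_word E v2 O bis_map G e F O converse (S_word E v1) \<in> bis_map G e ` \<N>))"

end

theory Submission
  imports Defs
begin

text \<open>
  On a small bisection, \<open>\<sigma> g \<sigma>\<^sup>-\<^sup>1\<close> traces out a bisection again, so the shift of the groupoid is
  continuous and open. By compactness an absorbing compact set can therefore be enlarged to a compact
  open absorbing set \<open>D\<close> that is mapped into itself. Cover \<open>D\<close> by finitely many compact open
  bisections \<open>F\<^sub>j\<close>. A bisection contained in \<open>D\<close> coincides with some \<open>F\<^sub>j\<close>, or is empty, over every
  sufficiently small cylinder of sources, with the size \<open>k\<close> of the cylinders uniform over the finitely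
  many \<open>S\<^sub>y\<^sup>-\<^sup>1 F\<^sub>j S\<^sub>x\<close>. Since the shift expands sources, this recurs: for all words \<open>u\<close>, \<open>v\<close>
  of equal length, \<open>S\<^sub>v\<^sup>-\<^sup>1 F\<^sub>j S\<^sub>u\<close> is an \<open>F\<^sub>i\<close> or empty over every cylinder of length \<open>k\<close>. Hence
  for words of length at least \<open>k\<close> only the finitely many bisections \<open>S\<^sub>v\<^sup>-\<^sup>1 F\<^sub>i S\<^sub>u\<close> with words of length \<open>k\<close> can
  occur, which gives condition (3), and the decreasing images of \<open>D\<close> take only finitely many values,
  so they stabilize at the nucleus.
\<close>

section \<open>Local homeomorphisms, compactness and germs\<close>

lemma local_homeomorphism_imp_open_map:
  assumes "local_homeomorphism_map Y Z f"
  shows "open_map Y Z f"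
  unfolding open_map_def
proof (intro allI impI)
  fix A assume A: "openin Y A"
  show "openin Z (f ` A)"
  proof (subst openin_subopen, intro ballI)
    fix z assume "z \<in> f ` A"
    then obtain y where y: "y \<in> A" "z = f y" by blast
    then have "y \<in> topspace Y" using A openin_subset by blast
    then obtain U V where UV: "openin Y U" "y \<in> U" "openin Z V"
      "homeomorphic_map (subtopology Y U) (subtopology Z V) f"
      using assms unfolding local_homeomorphism_map_def by blast
    have "openin (subtopology Y U) (A \<inter> U)"
      using A by (auto simp: openin_subtopology)
    then have "openin (subtopology Z V) (f ` (A \<inter> U))"
      using homeomorphic_imp_open_map[OF UV(4)] by (simp add: open_map_def)
    then have "openin Z (f ` (A \<inter> U))"
      using UV(3) openin_trans_full by blast
    then show "\<exists>T. openin Z T \<and> z \<in> T \<and> T \<subseteq> f ` A" using y UV(2) by blast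
  qed
qed

lemma local_homeomorphism_imp_continuous_map:
  assumes "local_homeomorphism_map Y Z f"
  shows "continuous_map Y Z f"
proof -
  have fY: "f y \<in> topspace Z" if "y \<in> topspace Y" for y
    using open_map_imp_subset_topspace[OF local_homeomorphism_imp_open_map[OF assms]] that by blast
  have "openin Y {y \<in> topspace Y. f y \<in> B}" if B: "openin Z B" for B
  proof (subst openin_subopen, intro ballI)
    fix y assume y: "y \<in> {y \<in> topspace Y. f y \<in> B}"
    then obtain U V where UV: "openin Y U" "y \<in> U" "openin Z V"
      "homeomorphic_map (subtopology Y U) (subtopology Z V) f"
      using assms unfolding local_homeomorphism_map_def by blast
    have "openin (subtopology Z V) (B \<inter> V)"
      using B by (auto simp: openin_subtopology)
    then have "openin (subtopology Y U) {u \<in> topspace (subtopology Y U). f u \<in> B \<inter> V}"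
      by (rule openin_continuous_map_preimage[OF homeomorphic_imp_continuous_map[OF UV(4)]])
    then have "openin Y {u \<in> topspace (subtopology Y U). f u \<in> B \<inter> V}"
      using UV(1) openin_trans_full by blast
    moreover have "f y \<in> V"
      using homeomorphic_imp_surjective_map[OF UV(4)] y UV(2) by auto
    ultimately show "\<exists>T. openin Y T \<and> y \<in> T \<and> T \<subseteq> {y \<in> topspace Y. f y \<in> B}"
      using y UV(2) by (intro exI[of _ "{u \<in> topspace (subtopology Y U). f u \<in> B \<inter> V}"]) auto
  qed
  then show ?thesis using fY by (simp add: continuous_map_def)
qed

lemma local_homeomorphism_imp_locally_inj:
  assumes "local_homeomorphism_map Y Z f" "y \<in> topspace Y"
  obtains U where "openin Y U" "y \<in> U" "inj_on f U"
proof -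
  obtain U V where UV: "openin Y U" "y \<in> U" "openin Z V"
      "homeomorphic_map (subtopology Y U) (subtopology Z V) f"
    using assms unfolding local_homeomorphism_map_def by blast
  have "topspace (subtopology Y U) = U"
    using openin_subset[OF UV(1)] by auto
  then show ?thesis using that UV homeomorphic_imp_injective_map by metis
qed

text \<open>\<open>U\<close> need not be increasing: a finite subcover only bounds the indices that
  occur. This turns depths chosen point by point into uniform ones.\<close>

lemma compactin_subset_UN_atMost:
  fixes U :: "nat \<Rightarrow> 'b set"
  assumes "compactin Y C" "\<And>n. openin Y (U n)" "C \<subseteq> (\<Union>n. U n)"
  obtains K where "C \<subseteq> (\<Union>n\<le>K. U n)"
proof -
  obtain \<F> where F: "finite \<F>" "\<F> \<subseteq> range U" "C \<subseteq> \<Union>\<F>"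
    using compactinD[OF assms(1), of "range U"] assms(2,3) by blast
  then obtain I where I: "finite I" "\<F> = U ` I" by (meson finite_subset_image)
  obtain K where "\<forall>i\<in>I. i \<le> K" using I(1) finite_nat_set_iff_bounded_le by auto
  have "C \<subseteq> (\<Union>n\<le>K. U n)"
  proof
    fix x assume "x \<in> C"
    then obtain i where "i \<in> I" "x \<in> U i" using F(3) unfolding I(2) by blast
    then show "x \<in> (\<Union>n\<le>K. U n)" using \<open>\<forall>i\<in>I. i \<le> K\<close> by (intro UN_I[of i]) simp_all
  qed
  then show ?thesis by (rule that)
qed

text \<open>The second component of a germ is a class under agreement near \<open>x\<close>. The
  class contains \<open>f\<close> itself because \<open>topspace E\<close> is a neighbourhood of
  \<open>x\<close>.\<close>

lemma germ_eq_iff: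
  assumes "x \<in> topspace E"
  shows "germ E f x = germ E f' x' \<longleftrightarrow>
    x = x' \<and> (\<exists>W. openin E W \<and> x \<in> W \<and> f \<inter> (W \<times> UNIV) = f' \<inter> (W \<times> UNIV))"
proof
  assume L: "germ E f x = germ E f' x'"
  have "f \<in> snd (germ E f x)"
    using assms unfolding germ_def by auto
  then have "f \<in> snd (germ E f' x')" by (simp only: L)
  then show "x = x' \<and> (\<exists>W. openin E W \<and> x \<in> W \<and> f \<inter> (W \<times> UNIV) = f' \<inter> (W \<times> UNIV))"
    using L unfolding germ_def by auto
next
  assume R: "x = x' \<and> (\<exists>W. openin E W \<and> x \<in> W \<and> f \<inter> (W \<times> UNIV) = f' \<inter> (W \<times> UNIV))"
  then obtain W where W: "openin E W" "x \<in> W" "f \<inter> (W \<times> UNIV) = f' \<inter> (W \<times> UNIV)" by blast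
  have sub: "{h. \<exists>W. openin E W \<and> x \<in> W \<and> h \<inter> (W \<times> UNIV) = p \<inter> (W \<times> UNIV)}
    \<subseteq> {h. \<exists>W. openin E W \<and> x \<in> W \<and> h \<inter> (W \<times> UNIV) = q \<inter> (W \<times> UNIV)}"
    if pq: "p \<inter> (W \<times> UNIV) = q \<inter> (W \<times> UNIV)" for p q :: "('a \<times> 'a) set"
  proof clarify
    fix h V assume V: "openin E V" "x \<in> V" "h \<inter> (V \<times> UNIV) = p \<inter> (V \<times> UNIV)"
    have "h \<inter> ((V \<inter> W) \<times> UNIV) = q \<inter> ((V \<inter> W) \<times> UNIV)" using V pq by blast
    then show "\<exists>W. openin E W \<and> x \<in> W \<and> h \<inter> (W \<times> UNIV) = q \<inter> (W \<times> UNIV)"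
      using V W by (intro exI[of _ "V \<inter> W"]) auto
  qed
  show "germ E f x = germ E f' x'"
    using R sub[OF W(3)] sub[OF W(3)[symmetric]] by (auto simp: germ_def)
qed

section \<open>Spaces of sequences\<close>

lemma shift_case_nat [simp]: "shift (case_nat x w) = w"
  by (simp add: shift_def)

lemma case_nat_shift: "case_nat (w 0) (shift w) = w"
  by (auto simp: shift_def fun_eq_iff split: nat.split)

lemma funpow_shift: "(shift ^^ n) w i = w (n + i)"
  by (induction n arbitrary: i) (simp_all add: shift_def)

lemma less_add_cases: "(\<forall>i<n + m. P i) \<longleftrightarrow> (\<forall>i<n. P i) \<and> (\<forall>i<m. P (n + i))" for n m :: nat
  by (metis add_less_cancel_left le_add_diff_inverse linorder_not_le trans_less_add1)

lemma finite_words: "finite X \<Longrightarrow> finite (words X m)"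
  unfolding words_def by (rule finite_lists_length_eq)

text \<open>The prefix is taken from a full sequence \<open>a\<close>, which may lie outside the
  space, so that cylinders of all lengths around a point share one parameter.\<close>

definition cyl :: "(nat \<Rightarrow> 'a) topology \<Rightarrow> nat \<Rightarrow> (nat \<Rightarrow> 'a) \<Rightarrow> (nat \<Rightarrow> 'a) set" where
  "cyl E k a = {w \<in> topspace E. \<forall>i<k. w i = a i}"

lemma topspace_markov_space: "topspace (markov_space X T) = markov_chain X T"
  by (auto simp: markov_space_def markov_chain_def)

lemma shift_in_markov_chain: "w \<in> markov_chain X T \<Longrightarrow> shift w \<in> markov_chain X T"
  by (auto simp: shift_def markov_chain_def)

lemma continuous_map_markov_coordinate:
  "continuous_map (markov_space X T) (discrete_topology X) (\<lambda>w. w i)"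
  unfolding markov_space_def
  by (intro continuous_map_from_subtopology continuous_map_product_projection) auto

lemma clopen_markov_coordinate:
  fixes X T
  defines "E \<equiv> markov_space X T"
  shows "openin E {w \<in> topspace E. w i \<in> A}" "closedin E {w \<in> topspace E. w i \<in> A}"
proof -
  \<comment> \<open>Open and closed sets of \<open>discrete_topology X\<close> are subsets of
    \<open>X\<close>, so \<open>A\<close> is first cut down to \<open>X\<close>.\<close>
  have *: "{w \<in> topspace E. w i \<in> A} = {w \<in> topspace E. w i \<in> A \<inter> X}"
    unfolding E_def by (auto simp: topspace_markov_space markov_chain_def)
  show "openin E {w \<in> topspace E. w i \<in> A}" unfolding * unfolding E_def
    by (rule openin_continuous_map_preimage[OF continuous_map_markov_coordinate]) auto
  show "closedin E {w \<in> topspace E. w i \<in> A}" unfolding * unfolding E_def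
    by (rule closedin_continuous_map_preimage[OF continuous_map_markov_coordinate]) auto
qed

lemma clopen_cyl:
  "openin (markov_space X T) (cyl (markov_space X T) k a)"
  "closedin (markov_space X T) (cyl (markov_space X T) k a)"
proof (induction k)
  case 0
  { case 1 show ?case by (simp add: cyl_def) next case 2 show ?case by (simp add: cyl_def) }
next
  case (Suc k)
  have eq: "cyl (markov_space X T) (Suc k) a = cyl (markov_space X T) k a \<inter>
      {w \<in> topspace (markov_space X T). w k \<in> {a k}}"
    by (auto simp: cyl_def less_Suc_eq)
  { case 1 show ?case unfolding eq
      using Suc.IH(1) clopen_markov_coordinate(1) by (rule openin_Int)
  next
    case 2 show ?case unfolding eq
      using Suc.IH(2) clopen_markov_coordinate(2) by (rule closedin_Int) }
qed

text \<open>A basic open set of the product restricts only finitely many coordinates; any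
  \<open>k\<close> beyond all of them works.\<close>

lemma cyl_base:
  assumes "openin (markov_space X T) W" "a \<in> W"
  obtains k where "cyl (markov_space X T) k a \<subseteq> W"
proof -
  obtain W' where W': "openin (product_topology (\<lambda>_. discrete_topology X) (UNIV::nat set)) W'"
    "W = W' \<inter> markov_chain X T"
    using assms(1) by (auto simp: markov_space_def openin_subtopology)
  then obtain U where U: "finite {i. U i \<noteq> X}" "a \<in> PiE UNIV U" "PiE UNIV U \<subseteq> W'"
    using assms(2) unfolding openin_product_topology_alt by auto
  obtain k where k: "\<forall>i\<in>{i. U i \<noteq> X}. i < k"
    using U(1) finite_nat_set_iff_bounded by auto
  have "cyl (markov_space X T) k a \<subseteq> W"
  proof
    fix w assume w: "w \<in> cyl (markov_space X T) k a"
    then have wX: "w \<in> markov_chain X T" by (simp add: cyl_def topspace_markov_space)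
    have "w i \<in> U i" for i
    proof (cases "i < k")
      case True then show ?thesis using w U(2) by (auto simp: cyl_def PiE_iff)
    next
      case False then have "U i = X" using k by auto
      then show ?thesis using wX by (auto simp: markov_chain_def)
    qed
    then show "w \<in> W" using U(3) W' wX by (auto simp: PiE_iff)
  qed
  then show ?thesis by (rule that)
qed

text \<open>The chain is cut out of the compact product by conditions on adjacent pairs of letters,
  each closed as a preimage from a discrete space.\<close>

lemma compact_markov_space:
  assumes "finite X" shows "compact_space (markov_space X T)"
proof -
  let ?P = "product_topology (\<lambda>_::nat. discrete_topology X) UNIV"
  have P: "continuous_map ?P (discrete_topology X) (\<lambda>w. w i)" for i
    by (rule continuous_map_product_projection) auto
  have "markov_chain X T =
    (\<Inter>n. {w \<in> topspace ?P. (w n, w (Suc n)) \<in> T \<inter> X \<times> X})"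
    by (auto simp: markov_chain_def PiE_iff)
  moreover have "closedin ?P {w \<in> topspace ?P. (w n, w (Suc n)) \<in> T \<inter> X \<times> X}" for n
    by (rule closedin_continuous_map_preimage[OF continuous_map_pairedI[OF P P]])
      (auto simp flip: prod_topology_discrete_topology)
  ultimately have "closedin ?P (markov_chain X T)"
    by (metis (no_types, lifting) closedin_Inter empty_not_UNIV imageE image_is_empty)
  moreover have "compact_space ?P"
    using assms by (simp add: compact_space_product_topology compact_space_discrete_topology)
  ultimately have "compactin ?P (markov_chain X T)"
    using closedin_compact_space by blast
  then show ?thesis by (simp add: markov_space_def compact_space_subtopology)
qed

lemma Hausdorff_markov_space: "Hausdorff_space (markov_space X T)"
  unfolding markov_space_def
  by (intro Hausdorff_space_subtopology) (simp add: Hausdorff_space_product_topology)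

section \<open>Bisections and germs\<close>

context groupoid begin

lemma inv_composable: "g \<in> elems G \<Longrightarrow> (ginv G g, g) \<in> composable G"
  by (simp add: composable_def inv_closed src_def rng_def inv_inv)

lemma src_inv: "g \<in> elems G \<Longrightarrow> src G (ginv G g) = rng G g"
  by (simp add: src_def rng_def inv_inv)

lemma rng_inv: "g \<in> elems G \<Longrightarrow> rng G (ginv G g) = src G g"
  by (simp add: src_def rng_def inv_inv)

lemma src_in_elems: "g \<in> elems G \<Longrightarrow> src G g \<in> elems G"
  unfolding src_def by (intro mult_closed inv_composable)

lemma units_subset_elems: "units G \<subseteq> elems G"
  unfolding units_def using src_in_elems by blast

lemma topspace_unit_top: "topspace (unit_top G) = units G"
  using units_subset_elems by auto

lemma src_in_units: "g \<in> elems G \<Longrightarrow> src G g \<in> units G"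
  by (simp add: units_def)

lemma rng_in_units: "g \<in> elems G \<Longrightarrow> rng G g \<in> units G"
  using src_in_units[OF inv_closed, of g] by (simp add: src_inv)

lemma src_unit: "u \<in> units G \<Longrightarrow> src G u = u"
  unfolding units_def using src_mult[OF inv_composable] by (auto simp: src_def)

lemma inv_mult_composable:
  assumes "g \<in> elems G" "h \<in> elems G" "rng G g = rng G h"
  shows "(ginv G h, g) \<in> composable G"
  using assms by (simp add: composable_def inv_closed src_inv)

text \<open>A unit equals its own source and range, so \<open>h\<^sup>-\<^sup>1 g\<close> is the
  common source of \<open>g\<close> and \<open>h\<close>; cancelling
  \<open>h\<^sup>-\<^sup>1\<close> gives the equality.\<close>

lemma inv_mult_unit_imp_eq:
  assumes "g \<in> elems G" "h \<in> elems G" "rng G g = rng G h"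
    and unit: "gmult G (ginv G h) g \<in> units G"
  shows "g = h"
proof -
  have c: "(ginv G h, g) \<in> composable G" by (rule inv_mult_composable[OF assms(1-3)])
  have k: "gmult G (ginv G h) g = src G g"
    using src_unit[OF unit] src_mult[OF c] by simp
  have "rng G (gmult G (ginv G h) g) = src G (gmult G (ginv G h) g)"
  proof -
    obtain y where y: "y \<in> elems G" "gmult G (ginv G h) g = src G y"
      using unit by (auto simp: units_def)
    have "rng G (src G y) = rng G (ginv G y)"
      unfolding src_def[of G y] by (rule rng_mult[OF inv_composable[OF y(1)]])
    then show ?thesis using y src_unit[OF src_in_units[OF y(1)]] by (simp add: rng_inv)
  qed
  then have "src G h = src G g"
    using rng_mult[OF c] k src_unit[OF src_in_units[OF assms(1)]] by (simp add: rng_inv[OF assms(2)])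
  then have "gmult G (ginv G h) g = gmult G (ginv G h) h"
    using k by (simp add: src_def)
  then show ?thesis
    using inv_mult_cancel[OF c] inv_mult_cancel[OF inv_composable[OF assms(2)]]
    by simp
qed

end

locale markov_groupoid = shift_invariant_groupoid E G e
  for E :: "(nat \<Rightarrow> 'a) topology" and G :: "'g groupoid_data" and e :: "'g \<Rightarrow> nat \<Rightarrow> 'a" +
  fixes X :: "'a set" and T :: "('a \<times> 'a) set"
  assumes finite_X: "finite X" and E_eq: "E = markov_space X T"
begin

section \<open>Source and range as sequences\<close>

abbreviation "s \<equiv> src_seq G e"
abbreviation "r \<equiv> rng_seq G e"
abbreviation "\<zeta> \<equiv> varsigma E G e"

lemma e_continuous: "continuous_map (unit_top G) E e"
  using unit_space by (rule homeomorphic_imp_continuous_map)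

lemma e_open: "open_map (unit_top G) E e"
  using unit_space by (rule homeomorphic_imp_open_map)

lemma e_inj: "inj_on e (units G)"
  using homeomorphic_imp_injective_map[OF unit_space] by (simp only: topspace_unit_top)

lemma s_eq: "s = e \<circ> src G" and r_eq: "r = e \<circ> rng G"
  by (auto simp: src_seq_def rng_seq_def)

lemma s_continuous: "continuous_map (gtop G) E s"
  unfolding s_eq using local_homeomorphism_imp_continuous_map[OF src_local_homeomorphism] e_continuous
  by (rule continuous_map_compose)

lemma r_continuous: "continuous_map (gtop G) E r"
  unfolding r_eq using local_homeomorphism_imp_continuous_map[OF rng_local_homeomorphism] e_continuous
  by (rule continuous_map_compose)

lemma s_open: "open_map (gtop G) E s"
  unfolding s_eq using local_homeomorphism_imp_open_map[OF src_local_homeomorphism] e_open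
  by (rule open_map_compose)

lemma s_in: "g \<in> elems G \<Longrightarrow> s g \<in> topspace E"
  using s_continuous by (auto simp: continuous_map_def)

lemma r_in: "g \<in> elems G \<Longrightarrow> r g \<in> topspace E"
  using r_continuous by (auto simp: continuous_map_def)

lemma s_eq_iff: "g \<in> elems G \<Longrightarrow> h \<in> elems G \<Longrightarrow> s g = s h \<longleftrightarrow> src G g = src G h"
  unfolding src_seq_def using e_inj src_in_units by (auto dest: inj_onD)

lemma r_eq_iff: "g \<in> elems G \<Longrightarrow> h \<in> elems G \<Longrightarrow> r g = r h \<longleftrightarrow> rng G g = rng G h"
  unfolding rng_seq_def using e_inj rng_in_units by (auto dest: inj_onD)

text \<open>Kept general in \<open>f\<close> to serve both source and range. Images are open in the
  unit space only; since the image of \<open>U\<close> consists of units, this is enough for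
  openness relative to that image.\<close>

lemma open_inj_imp_homeomorphic:
  assumes U: "openin (gtop G) U" and f: "local_homeomorphism_map (gtop G) (unit_top G) f"
    and inj: "inj_on f U"
  shows "homeomorphic_map (subtopology (gtop G) U) (subtopology (gtop G) (f ` U)) f"
proof (rule bijective_open_imp_homeomorphic_map)
  have UG: "U \<subseteq> elems G" using U by (rule openin_subset)
  have c: "continuous_map (gtop G) (unit_top G) f"
    using f by (rule local_homeomorphism_imp_continuous_map)
  have o: "open_map (gtop G) (unit_top G) f"
    using f by (rule local_homeomorphism_imp_open_map)
  have fU: "f ` U \<subseteq> elems G"
    using c UG by (auto simp: continuous_map_def)
  have "continuous_map (gtop G) (gtop G) f"
    using c by (simp add: continuous_map_in_subtopology)
  then show "continuous_map (subtopology (gtop G) U) (subtopology (gtop G) (f ` U)) f"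
    by (auto simp: continuous_map_in_subtopology intro: continuous_map_from_subtopology)
  show "open_map (subtopology (gtop G) U) (subtopology (gtop G) (f ` U)) f"
    unfolding open_map_def
  proof (intro allI impI)
    fix A assume "openin (subtopology (gtop G) U) A"
    then have A: "openin (gtop G) A" "A \<subseteq> U"
      using U openin_trans_full openin_imp_subset by blast+
    then obtain B where "openin (gtop G) B" "f ` A = B \<inter> units G"
      using o by (auto simp: open_map_def openin_subtopology)
    moreover have "f ` U \<subseteq> units G"
      using c UG by (auto simp: continuous_map_def topspace_unit_top)
    moreover have "f ` A \<subseteq> f ` U" using A by blast
    ultimately have "openin (gtop G) B \<and> f ` A = B \<inter> f ` U" by blast
    then show "openin (subtopology (gtop G) (f ` U)) (f ` A)"
      unfolding openin_subtopology by blast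
  qed
  show "f ` topspace (subtopology (gtop G) U) = topspace (subtopology (gtop G) (f ` U))"
    using UG fU by auto
  show "inj_on f (topspace (subtopology (gtop G) U))"
    using inj by (auto simp: inj_on_def)
qed

text \<open>For open sets injectivity suffices, because source and range are local homeomorphisms
  and \<open>e\<close> is injective on units. Later arguments use only this form.\<close>

lemma open_bisection_iff:
  "open_bisection G U \<longleftrightarrow> openin (gtop G) U \<and> inj_on s U \<and> inj_on r U"
proof (cases "openin (gtop G) U")
  case True
  then have UG: "U \<subseteq> elems G" by (rule openin_subset)
  then have top: "topspace (subtopology (gtop G) U) = U" by auto
  have s: "inj_on s U \<longleftrightarrow> inj_on (src G) U"
    unfolding inj_on_def using s_eq_iff UG by blast
  have r: "inj_on r U \<longleftrightarrow> inj_on (rng G) U"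
    unfolding inj_on_def using r_eq_iff UG by blast
  show ?thesis
    using True UG s r open_inj_imp_homeomorphic[OF True src_local_homeomorphism]
      open_inj_imp_homeomorphic[OF True rng_local_homeomorphism]
      homeomorphic_imp_injective_map[of "subtopology (gtop G) U"]
    unfolding open_bisection_def bisection_def top by blast
qed (simp add: open_bisection_def)

lemma compact_open_bisection_iff:
  "compact_open_bisection G U \<longleftrightarrow> compactin (gtop G) U \<and> open_bisection G U"
  by (auto simp: compact_open_bisection_def open_bisection_def)

lemma open_bisection_subset:
  "open_bisection G U \<Longrightarrow> openin (gtop G) V \<Longrightarrow> V \<subseteq> U \<Longrightarrow> open_bisection G V"
  by (auto simp: open_bisection_iff intro: inj_on_subset)

lemma open_bisection_elems: "open_bisection G U \<Longrightarrow> U \<subseteq> elems G"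
  by (auto simp: open_bisection_iff dest: openin_subset)

lemma openin_s_preimage:
  assumes "openin (gtop G) U" "openin E W" shows "openin (gtop G) {g \<in> U. s g \<in> W}"
proof -
  have "openin (gtop G) (U \<inter> {g \<in> elems G. s g \<in> W})"
    using assms openin_continuous_map_preimage[OF s_continuous] by blast
  then show ?thesis using openin_subset[OF assms(1)]
    by (smt (verit) Collect_cong Int_def mem_Collect_eq subsetD)
qed

lemma openin_r_preimage:
  assumes "openin (gtop G) U" "openin E W" shows "openin (gtop G) {g \<in> U. r g \<in> W}"
proof -
  have "openin (gtop G) (U \<inter> {g \<in> elems G. r g \<in> W})"
    using assms openin_continuous_map_preimage[OF r_continuous] by blast
  then show ?thesis using openin_subset[OF assms(1)]
    by (smt (verit) Collect_cong Int_def mem_Collect_eq subsetD)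
qed

lemma openin_s_image: "openin (gtop G) U \<Longrightarrow> openin E (s ` U)"
  using s_open by (simp add: open_map_def)

lemma ex_open_bisection:
  assumes "openin (gtop G) O'" "g \<in> O'"
  obtains U where "open_bisection G U" "g \<in> U" "U \<subseteq> O'"
proof -
  have g: "g \<in> elems G" using assms openin_subset by blast
  obtain A where A: "openin (gtop G) A" "g \<in> A" "inj_on (src G) A"
    using local_homeomorphism_imp_locally_inj[OF src_local_homeomorphism g] .
  obtain B where B: "openin (gtop G) B" "g \<in> B" "inj_on (rng G) B"
    using local_homeomorphism_imp_locally_inj[OF rng_local_homeomorphism g] .
  have AB: "A \<subseteq> elems G" "B \<subseteq> elems G" using A B openin_subset by blast+
  have "open_bisection G (A \<inter> B \<inter> O')"
    unfolding open_bisection_iff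
  proof (intro conjI)
    show "openin (gtop G) (A \<inter> B \<inter> O')" using A B assms by blast
    show "inj_on s (A \<inter> B \<inter> O')" using A AB s_eq_iff unfolding inj_on_def by blast
    show "inj_on r (A \<inter> B \<inter> O')" using B AB r_eq_iff unfolding inj_on_def by blast
  qed
  then show ?thesis using that A B assms by blast
qed

lemma bis_at:
  assumes "g \<in> elems G" shows "open_bisection G (bis_at G g)" "g \<in> bis_at G g"
proof -
  have "\<exists>U. open_bisection G U \<and> g \<in> U"
    using ex_open_bisection[OF openin_topspace assms] by blast
  then have "open_bisection G (bis_at G g) \<and> g \<in> bis_at G g"
    unfolding bis_at_def by (rule someI_ex)
  then show "open_bisection G (bis_at G g)" "g \<in> bis_at G g" by auto
qed

lemma bis_map_iff: "(x, y) \<in> bis_map G e U \<longleftrightarrow> (\<exists>h\<in>U. s h = x \<and> r h = y)"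
  by (auto simp: bis_map_def)

text \<open>The witness is the source image of \<open>U \<inter> V\<close>, open since
  \<open>s\<close> is an open map. Over it, injectivity of \<open>s\<close> on each bisection forces
  the elements into the intersection.\<close>

lemma bis_map_Int:
  assumes U: "open_bisection G U" and V: "open_bisection G V" and "g \<in> U" "g \<in> V"
  obtains W where "openin E W" "s g \<in> W"
    "bis_map G e U \<inter> (W \<times> UNIV) = bis_map G e V \<inter> (W \<times> UNIV)"
proof
  show "openin E (s ` (U \<inter> V))" using U V
    by (intro openin_s_image) (auto simp: open_bisection_iff)
  have *: "bis_map G e A \<inter> (s ` (A \<inter> B) \<times> UNIV) \<subseteq> bis_map G e B" if "open_bisection G A" for A B
    using that by (auto simp: bis_map_iff open_bisection_iff inj_on_def) (metis)
  show "bis_map G e U \<inter> (s ` (U \<inter> V) \<times> UNIV) = bis_map G e V \<inter> (s ` (U \<inter> V) \<times> UNIV)"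
    using *[OF U, of V] *[OF V, of U] by (auto simp: Int_commute)
qed (use assms in auto)

text \<open>Removes the arbitrary choice made by \<open>bis_at\<close>.\<close>

lemma elem_germ_eq:
  assumes "open_bisection G U" "g \<in> U"
  shows "elem_germ E G e g = germ E (bis_map G e U) (s g)"
proof -
  have g: "g \<in> elems G" using assms open_bisection_elems by blast
  obtain W where "openin E W" "s g \<in> W"
    "bis_map G e (bis_at G g) \<inter> (W \<times> UNIV) = bis_map G e U \<inter> (W \<times> UNIV)"
    using bis_map_Int[OF bis_at(1)[OF g] assms(1) bis_at(2)[OF g] assms(2)] .
  then show ?thesis unfolding elem_germ_def by (subst germ_eq_iff[OF s_in[OF g]]) blast
qed

text \<open>
  If \<open>g\<close> and \<open>h\<close> have the same germ, then all elements near \<open>h\<^sup>-\<^sup>1 g\<close> have equal source and range,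
  so \<open>h\<^sup>-\<^sup>1 g\<close> is a unit by effectiveness.
\<close>

lemma elem_germ_inj:
  assumes g: "g \<in> elems G" and h: "h \<in> elems G" and eq: "elem_germ E G e g = elem_germ E G e h"
  shows "g = h"
proof -
  obtain U where U: "open_bisection G U" "g \<in> U"
    using bis_at[OF g] by blast
  obtain V where V: "open_bisection G V" "h \<in> V"
    using bis_at[OF h] by blast
  have UG: "U \<subseteq> elems G" and VG: "V \<subseteq> elems G" using U V open_bisection_elems by blast+
  have "germ E (bis_map G e U) (s g) = germ E (bis_map G e V) (s h)"
    using eq elem_germ_eq[OF U] elem_germ_eq[OF V] by simp
  then obtain W where sgh: "s g = s h" and W: "openin E W" "s g \<in> W"
    "bis_map G e U \<inter> (W \<times> UNIV) = bis_map G e V \<inter> (W \<times> UNIV)"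
    unfolding germ_eq_iff[OF s_in[OF g]] by blast
  have agree: "r u = r v" if "u \<in> U" "v \<in> V" "s u = s v" "s u \<in> W" for u v
  proof -
    have "(s u, r u) \<in> bis_map G e U \<inter> (W \<times> UNIV)" using that by (auto simp: bis_map_iff)
    then obtain v' where "v' \<in> V" "s v' = s u" "r v' = r u"
      unfolding W(3) by (auto simp: bis_map_iff)
    then show ?thesis using that V(1) by (metis inj_onD open_bisection_iff)
  qed
  have rgh: "rng G g = rng G h"
    using agree[OF U(2) V(2) sgh W(2)] r_eq_iff g h by simp
  have src_gh: "src G g = src G h" using sgh s_eq_iff g h by simp
  let ?m = "\<lambda>(a, b). gmult G (ginv G a) b"
  let ?P = "prod_topology (gtop G) (gtop G)"
  \<comment> \<open>The pairs for which \<open>a\<^sup>-\<^sup>1 b\<close> is defined; on them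
    division is continuous.\<close>
  define D where "D = {(a, b). a \<in> elems G \<and> b \<in> elems G \<and> rng G a = rng G b}"
  have cont: "continuous_map (subtopology ?P D) (gtop G) ?m"
  proof -
    have "continuous_map ?P ?P (\<lambda>p. (ginv G (fst p), snd p))"
      by (intro continuous_map_pairedI continuous_map_compose[OF continuous_map_fst continuous_inv,
            unfolded o_def] continuous_map_snd)
    then have "continuous_map (subtopology ?P D) (subtopology ?P (composable G))
        (\<lambda>p. (ginv G (fst p), snd p))"
      by (auto simp: continuous_map_in_subtopology D_def intro: continuous_map_from_subtopology
          inv_mult_composable)
    from continuous_map_compose[OF this continuous_mult] show ?thesis
      by (simp add: o_def case_prod_beta')
  qed
  define k where "k = gmult G (ginv G h) g"
  have k: "k \<in> elems G" "src G k = src G g"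
    unfolding k_def using inv_mult_composable[OF g h rgh] mult_closed src_mult by auto
  have "k \<in> units G"
  proof (rule ccontr)
    assume nu: "k \<notin> units G"
    obtain O' where O': "open_bisection G O'" "k \<in> O'"
      using bis_at[OF k(1)] by blast
    then have O'o: "openin (gtop G) O'" "inj_on s O'" "O' \<subseteq> elems G"
      by (auto simp: open_bisection_iff dest: openin_subset)
    have "openin (subtopology ?P D) {p \<in> topspace (subtopology ?P D). ?m p \<in> O'}"
      by (rule openin_continuous_map_preimage[OF cont O'o(1)])
    then obtain Q where Q: "openin ?P Q" "{p \<in> topspace (subtopology ?P D). ?m p \<in> O'} = Q \<inter> D"
      unfolding openin_subtopology by blast
    have "(h, g) \<in> D" using g h rgh by (simp add: D_def)
    then have "(h, g) \<in> {p \<in> topspace (subtopology ?P D). ?m p \<in> O'}"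
      using g h O'(2) by (simp add: k_def)
    then have hgQ: "(h, g) \<in> Q" unfolding Q(2) by blast
    obtain V' U' where VU: "openin (gtop G) V'" "openin (gtop G) U'" "h \<in> V'" "g \<in> U'"
      "V' \<times> U' \<subseteq> Q"
      using Q(1)[unfolded openin_prod_topology_alt, rule_format, OF hgQ] by blast
    have inO: "gmult G (ginv G a) b \<in> O'" if "a \<in> V'" "b \<in> U'" "(a, b) \<in> D" for a b
    proof -
      have "(a, b) \<in> Q \<inter> D" using that VU by blast
      then show ?thesis unfolding Q(2)[symmetric] by simp
    qed
    \<comment> \<open>Over \<open>W'\<close> each source is attained in both
      \<open>V \<inter> V'\<close> and \<open>U \<inter> U'\<close>, and the ranges agree there, so
      the quotient of the two elements exists and lies in \<open>O'\<close>.\<close>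
    define W' where "W' = W \<inter> s ` (V \<inter> V') \<inter> s ` (U \<inter> U')"
    have W': "openin E W'" unfolding W'_def
      using W(1) U(1) V(1) VU by (intro openin_Int openin_s_image) (auto simp: open_bisection_iff)
    have "s g \<in> s ` (U \<inter> U')" "s h \<in> s ` (V \<inter> V')" using U V VU by blast+
    then have "s g \<in> W'" unfolding W'_def using W(2) sgh by simp
    moreover have "s k = s g" using k by (simp add: src_seq_def)
    ultimately have kO: "k \<in> {p \<in> O'. s p \<in> W'}" using O'(2) by simp
    \<comment> \<open>Effectiveness is applied to the part of \<open>O'\<close> over
      \<open>W'\<close>, a neighbourhood of the supposed non-unit \<open>k\<close>.\<close>
    obtain p where p: "p \<in> O'" "s p \<in> W'" "src G p \<noteq> rng G p"
      using effective kO nu k(1) openin_s_preimage[OF O'o(1) W'] unfolding effective_def by blast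
    have pW: "s p \<in> W" "s p \<in> s ` (U \<inter> U')" "s p \<in> s ` (V \<inter> V')"
      using p(2) by (simp_all only: W'_def Int_iff)
    obtain u where u: "u \<in> U" "u \<in> U'" "s u = s p"
      using imageE[OF pW(2)] by (metis IntE)
    obtain v where v: "v \<in> V" "v \<in> V'" "s v = s p"
      using imageE[OF pW(3)] by (metis IntE)
    note uv = u v pW(1)
    have uvG: "u \<in> elems G" "v \<in> elems G" using uv UG VG by auto
    have rr: "rng G u = rng G v" using agree[of u v] uv uvG r_eq_iff by simp
    have c: "(ginv G v, u) \<in> composable G" by (rule inv_mult_composable[OF uvG rr])
    have "gmult G (ginv G v) u \<in> O'" using uv uvG rr by (intro inO) (auto simp: D_def)
    moreover have "s (gmult G (ginv G v) u) = s p"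
      using src_mult[OF c] uv by (simp add: src_seq_def)
    \<comment> \<open>\<open>p\<close> and the quotient lie in the same bisection and have the same
      source. The quotient, however, has equal source and range, contradicting the choice of
      \<open>p\<close>.\<close>
    ultimately have peq: "p = gmult G (ginv G v) u" using O'o(2) p(1) by (metis inj_onD)
    have "rng G p = src G v" unfolding peq using rng_mult[OF c] rng_inv uvG by simp
    moreover have "src G p = src G u" unfolding peq using src_mult[OF c] by simp
    moreover have "src G u = src G v" using uv uvG s_eq_iff by metis
    ultimately show False using p(3) by simp
  qed
  then show ?thesis using inv_mult_unit_imp_eq[OF g h rgh] by (simp add: k_def)
qed

section \<open>The shift on the groupoid\<close>

lemma topspace_E: "topspace E = markov_chain X T"
  by (simp add: E_eq topspace_markov_space)

lemma shift_in: "w \<in> topspace E \<Longrightarrow> shift w \<in> topspace E"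
  by (simp add: topspace_E shift_in_markov_chain)

lemma openin_shift_preimage:
  assumes "openin E W" shows "openin E {w \<in> topspace E. shift w \<in> W}"
proof (subst openin_subopen, intro ballI)
  fix w assume w: "w \<in> {w \<in> topspace E. shift w \<in> W}"
  obtain k where k: "cyl E k (shift w) \<subseteq> W"
    using cyl_base[of X T W "shift w"] assms w by (auto simp: E_eq)
  have "shift w' \<in> cyl E k (shift w)" if "w' \<in> cyl E (Suc k) w" for w'
    using that shift_in by (auto simp: cyl_def shift_def)
  then have "cyl E (Suc k) w \<subseteq> {w \<in> topspace E. shift w \<in> W}"
    using k by (auto simp: cyl_def)
  then show "\<exists>V. openin E V \<and> w \<in> V \<and> V \<subseteq> {w \<in> topspace E. shift w \<in> W}"
    using clopen_cyl(1)[of X T "Suc k" w] w by (auto simp: E_eq cyl_def)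
qed

lemma openin_case_nat_preimage:
  assumes "openin E W" shows "openin E {w \<in> topspace E. case_nat x w \<in> W}"
proof (subst openin_subopen, intro ballI)
  fix w assume w: "w \<in> {w \<in> topspace E. case_nat x w \<in> W}"
  then have xw: "case_nat x w \<in> markov_chain X T"
    using openin_subset[OF assms] topspace_E by auto
  obtain k where k: "cyl E k (case_nat x w) \<subseteq> W"
    using cyl_base[of X T W "case_nat x w"] assms w by (auto simp: E_eq)
  \<comment> \<open>Length \<open>Suc k\<close> guarantees that \<open>w'\<close> and
    \<open>w\<close> share at least their first letter, so that prefixing \<open>x\<close> is
    admissible for \<open>w'\<close> as well.\<close>
  have "case_nat x w' \<in> cyl E k (case_nat x w)" if w': "w' \<in> cyl E (Suc k) w" for w'
  proof -
    have "case_nat x w' n \<in> X \<and> (case_nat x w' n, case_nat x w' (Suc n)) \<in> T" for n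
    proof (cases n)
      case 0
      have "case_nat x w 0 \<in> X" "(case_nat x w 0, case_nat x w (Suc 0)) \<in> T"
        using xw unfolding markov_chain_def by blast+
      then show ?thesis using w' 0 by (auto simp: cyl_def)
    next
      case (Suc m)
      then show ?thesis using w' by (auto simp: cyl_def topspace_E markov_chain_def)
    qed
    then have "case_nat x w' \<in> topspace E" by (auto simp: topspace_E markov_chain_def)
    then show ?thesis using w' by (auto simp: cyl_def split: nat.split)
  qed
  then have "cyl E (Suc k) w \<subseteq> {w \<in> topspace E. case_nat x w \<in> W}"
    using k by (auto simp: cyl_def)
  then show "\<exists>V. openin E V \<and> w \<in> V \<and> V \<subseteq> {w \<in> topspace E. case_nat x w \<in> W}"
    using clopen_cyl(1)[of X T "Suc k" w] w by (auto simp: E_eq cyl_def)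
qed

text \<open>Turns the relational conjugate \<open>S\<^sub>y\<^sup>-\<^sup>1 U S\<^sub>x\<close> into
  a statement about elements: keep those whose source and range begin with \<open>x\<close> and
  \<open>y\<close>, and delete these letters.\<close>

lemma conj_letter_iff:
  assumes "U \<subseteq> elems G"
  shows "(w, w') \<in> S_letter E x O bis_map G e U O converse (S_letter E y) \<longleftrightarrow>
    (\<exists>h\<in>U. s h 0 = x \<and> r h 0 = y \<and> shift (s h) = w \<and> shift (r h) = w')"
proof
  assume "(w, w') \<in> S_letter E x O bis_map G e U O converse (S_letter E y)"
  then obtain h where "h \<in> U" "s h = case_nat x w" "r h = case_nat y w'"
    by (auto simp: S_letter_def bis_map_def)
  then show "\<exists>h\<in>U. s h 0 = x \<and> r h 0 = y \<and> shift (s h) = w \<and> shift (r h) = w'"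
    by (intro bexI[of _ h]) auto
next
  assume "\<exists>h\<in>U. s h 0 = x \<and> r h 0 = y \<and> shift (s h) = w \<and> shift (r h) = w'"
  then obtain h where h: "h \<in> U" "s h 0 = x" "r h 0 = y" "shift (s h) = w" "shift (r h) = w'"
    by blast
  then have hE: "h \<in> elems G" using assms by blast
  have "(w, s h) \<in> S_letter E x" "(w', r h) \<in> S_letter E y"
    using h s_in[OF hE] r_in[OF hE] shift_in case_nat_shift[of "s h"] case_nat_shift[of "r h"]
    by (auto simp: S_letter_def)
  moreover have "(s h, r h) \<in> bis_map G e U" using h(1) by (auto simp: bis_map_iff)
  ultimately show "(w, w') \<in> S_letter E x O bis_map G e U O converse (S_letter E y)" by blast
qed

text \<open>Independence of the chosen bisection: two choices agree over some \<open>W\<close>, and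
  prefixing a letter is continuous, so their conjugates agree over the preimage
  \<open>W'\<close>.\<close>

lemma shifted_germ_eq:
  assumes U: "open_bisection G U" "g \<in> U"
  shows "shifted_germ E G e g =
    germ E (S_letter E (s g 0) O bis_map G e U O converse (S_letter E (r g 0))) (shift (s g))"
proof -
  have g: "g \<in> elems G" using U open_bisection_elems by blast
  obtain W where W: "openin E W" "s g \<in> W"
    "bis_map G e (bis_at G g) \<inter> (W \<times> UNIV) = bis_map G e U \<inter> (W \<times> UNIV)"
    using bis_map_Int[OF bis_at(1)[OF g] U(1) bis_at(2)[OF g] U(2)] .
  let ?x = "s g 0" and ?y = "r g 0"
  define W' where "W' = {w \<in> topspace E. case_nat ?x w \<in> W}"
  have sub: "(S_letter E ?x O p O converse (S_letter E ?y)) \<inter> (W' \<times> UNIV)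
      \<subseteq> S_letter E ?x O q O converse (S_letter E ?y)"
    if "p \<inter> (W \<times> UNIV) = q \<inter> (W \<times> UNIV)" for p q
  proof clarify
    fix a b c d assume "(a, b) \<in> S_letter E ?x" "(b, c) \<in> p" "(d, c) \<in> S_letter E ?y" "a \<in> W'"
    then have "b \<in> W" by (auto simp: S_letter_def W'_def)
    then have "(b, c) \<in> q" using that \<open>(b, c) \<in> p\<close> by blast
    then show "(a, d) \<in> S_letter E ?x O q O converse (S_letter E ?y)"
      using \<open>(a, b) \<in> _\<close> \<open>(d, c) \<in> _\<close> by blast
  qed
  have "openin E W'" unfolding W'_def by (rule openin_case_nat_preimage[OF W(1)])
  moreover have "shift (s g) \<in> W'"
    using W(2) s_in[OF g] shift_in case_nat_shift[of "s g"] by (simp add: W'_def)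
  moreover have "(S_letter E ?x O bis_map G e (bis_at G g) O converse (S_letter E ?y)) \<inter> (W' \<times> UNIV)
      = (S_letter E ?x O bis_map G e U O converse (S_letter E ?y)) \<inter> (W' \<times> UNIV)"
    by (intro subset_antisym Int_greatest sub[OF W(3)] sub[OF W(3)[symmetric]] Int_lower2)
  ultimately show ?thesis
    unfolding shifted_germ_def germ_eq_iff[OF shift_in[OF s_in[OF g]]]
    by (intro conjI refl exI[of _ W'])
qed

text \<open>The description in \<open>varsigma\<close> is proper: existence is shift-invariance,
  uniqueness is injectivity of \<open>elem_germ\<close>.\<close>

lemma varsigma:
  assumes "g \<in> elems G"
  shows "\<zeta> g \<in> elems G" "elem_germ E G e (\<zeta> g) = shifted_germ E G e g"
proof -
  have "\<exists>!h. h \<in> elems G \<and> elem_germ E G e h = shifted_germ E G e g"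
    using shift_invariant assms elem_germ_inj by (auto simp: image_subset_iff) (metis imageE)
  then have "\<zeta> g \<in> elems G \<and> elem_germ E G e (\<zeta> g) = shifted_germ E G e g"
    unfolding varsigma_def by (rule theI')
  then show "\<zeta> g \<in> elems G" "elem_germ E G e (\<zeta> g) = shifted_germ E G e g" by auto
qed

lemma varsigma_eqI:
  assumes "g \<in> elems G" "h \<in> elems G" "elem_germ E G e h = shifted_germ E G e g"
  shows "\<zeta> g = h"
  using varsigma[OF assms(1)] assms elem_germ_inj by simp

text \<open>The base point is a component of the germ, so the source can be read off at once; the
  range requires the local description below.\<close>

lemma s_varsigma: "g \<in> elems G \<Longrightarrow> s (\<zeta> g) = shift (s g)"
  using varsigma(2)[of g] by (simp add: elem_germ_def shifted_germ_def germ_def)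

text \<open>Over a neighbourhood \<open>W\<close> of the shifted source, \<open>B\<close> agrees
  with the conjugate of \<open>A\<close> by the first letters. Hence \<open>\<zeta>\<close> maps
  each \<open>h\<close> near \<open>g\<close> to the element of \<open>B\<close> with both endpoints
  shifted, and the image is the part of \<open>B\<close> over \<open>W\<close>. Continuity, openness
  and the range formula all follow.\<close>

lemma varsigma_local:
  assumes A: "open_bisection G A" "g \<in> A" and B: "open_bisection G B" "\<zeta> g \<in> B"
  obtains A' where "openin (gtop G) A'" "g \<in> A'" "A' \<subseteq> A" "\<zeta> ` A' \<subseteq> B" "openin (gtop G) (\<zeta> ` A')"
    "\<And>h. h \<in> A' \<Longrightarrow> r (\<zeta> h) = shift (r h)"
proof -
  have AG: "A \<subseteq> elems G" and BG: "B \<subseteq> elems G" using A B open_bisection_elems by blast+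
  have g: "g \<in> elems G" using A AG by blast
  define x y where "x = s g 0" and "y = r g 0"
  define F where "F = S_letter E x O bis_map G e A O converse (S_letter E y)"
  have "germ E (bis_map G e B) (s (\<zeta> g)) = germ E F (shift (s g))"
    using varsigma(2)[OF g] elem_germ_eq[OF B] shifted_germ_eq[OF A] by (simp add: F_def x_def y_def)
  then obtain W where W: "openin E W" "s (\<zeta> g) \<in> W"
    "bis_map G e B \<inter> (W \<times> UNIV) = F \<inter> (W \<times> UNIV)"
    unfolding germ_eq_iff[OF s_in[OF varsigma(1)[OF g]]] by blast
  have Fiff: "(w, w') \<in> F \<longleftrightarrow>
      (\<exists>h\<in>A. s h 0 = x \<and> r h 0 = y \<and> shift (s h) = w \<and> shift (r h) = w')" for w w'
    unfolding F_def by (rule conj_letter_iff[OF AG])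
  define A' where "A' = {h \<in> A. s h 0 = x \<and> r h 0 = y \<and> shift (s h) \<in> W}"
  \<comment> \<open>Over \<open>W\<close> the germ of \<open>k\<close> is a germ of
    \<open>F\<close>, and this is the shifted germ of \<open>h\<close>, since \<open>h\<close> has
    the same first letters as \<open>g\<close>.\<close>
  have step: "\<zeta> h = k" if h: "h \<in> A'" and k: "k \<in> B" "s k = shift (s h)" "r k = shift (r h)" for h k
  proof (rule varsigma_eqI)
    have hA: "h \<in> A" "s h 0 = x" "r h 0 = y" "s k \<in> W" using h k by (auto simp: A'_def)
    show "h \<in> elems G" "k \<in> elems G" using hA AG k BG by auto
    have "elem_germ E G e k = germ E F (s k)"
      unfolding elem_germ_eq[OF B(1) k(1)] germ_eq_iff[OF s_in[OF \<open>k \<in> elems G\<close>]]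
      using W hA(4) by blast
    then show "elem_germ E G e k = shifted_germ E G e h"
      using shifted_germ_eq[OF A(1) hA(1)] hA k(2) by (simp add: F_def)
  qed
  have A'D: "\<zeta> h \<in> B \<and> s (\<zeta> h) = shift (s h) \<and> r (\<zeta> h) = shift (r h)" if h: "h \<in> A'" for h
  proof -
    have "(shift (s h), shift (r h)) \<in> F \<inter> (W \<times> UNIV)" using h Fiff by (auto simp: A'_def)
    then obtain k where k: "k \<in> B" "s k = shift (s h)" "r k = shift (r h)"
      unfolding W(3)[symmetric] by (auto simp: bis_map_iff)
    then show ?thesis using step[OF h k] by simp
  qed
  show ?thesis
  proof
    \<comment> \<open>Written as nested preimages of open sets under \<open>s\<close> and
      \<open>r\<close>.\<close>
    have eq: "A' = {h \<in> {h \<in> {h \<in> A. s h \<in> {w \<in> topspace E. w 0 \<in> {x}}}.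
        r h \<in> {w \<in> topspace E. w 0 \<in> {y}}}. s h \<in> {w \<in> topspace E. shift w \<in> W}}"
      unfolding A'_def using AG s_in r_in by auto
    have Ao: "openin (gtop G) A" using A(1) by (simp add: open_bisection_iff)
    have co: "openin E {w \<in> topspace E. w 0 \<in> Z}" for Z
      unfolding E_eq by (rule clopen_markov_coordinate)
    show "openin (gtop G) A'" unfolding eq
      by (intro openin_s_preimage openin_r_preimage Ao co openin_shift_preimage[OF W(1)])
    show "g \<in> A'" using A(2) W(2) s_varsigma[OF g] by (simp add: A'_def x_def y_def)
    show "A' \<subseteq> A" by (auto simp: A'_def)
    show "\<zeta> ` A' \<subseteq> B" using A'D by blast
    show "r (\<zeta> h) = shift (r h)" if "h \<in> A'" for h using A'D[OF that] by blast
    have "\<zeta> ` A' = {k \<in> B. s k \<in> W}"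
    proof (intro subset_antisym subsetI)
      fix k assume "k \<in> \<zeta> ` A'"
      then obtain h where h: "h \<in> A'" "k = \<zeta> h" by blast
      then show "k \<in> {k \<in> B. s k \<in> W}"
        using A'D[OF h(1)] by (simp add: A'_def)
    next
      fix k assume k: "k \<in> {k \<in> B. s k \<in> W}"
      then have "(s k, r k) \<in> bis_map G e B \<inter> (W \<times> UNIV)" by (auto simp: bis_map_iff)
      then have "(s k, r k) \<in> F" unfolding W(3) by blast
      then obtain h where h: "h \<in> A" "s h 0 = x" "r h 0 = y" "shift (s h) = s k" "shift (r h) = r k"
        unfolding Fiff by blast
      then have hA': "h \<in> A'" using k unfolding A'_def by simp
      have "\<zeta> h = k" using k h by (intro step[OF hA']) auto
      then show "k \<in> \<zeta> ` A'" using hA' by blast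
    qed
    moreover have "openin (gtop G) {k \<in> B. s k \<in> W}"
      using B(1) W(1) unfolding open_bisection_iff by (intro openin_s_preimage) blast+
    ultimately show "openin (gtop G) (\<zeta> ` A')" by simp
  qed
qed

lemma r_varsigma:
  assumes "g \<in> elems G" shows "r (\<zeta> g) = shift (r g)"
proof (rule varsigma_local[OF bis_at[OF assms] bis_at[OF varsigma(1)[OF assms]]])
  fix A' assume "g \<in> A'" and *: "\<And>h. h \<in> A' \<Longrightarrow> r (\<zeta> h) = shift (r h)"
  show ?thesis by (rule *) fact
qed

section \<open>Topology of the shift and its iterates\<close>

lemma varsigma_continuous: "continuous_map (gtop G) (gtop G) \<zeta>"
proof -
  have "openin (gtop G) {g \<in> elems G. \<zeta> g \<in> Q}" if Q: "openin (gtop G) Q" for Q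
  proof (subst openin_subopen, intro ballI)
    fix g assume "g \<in> {g \<in> elems G. \<zeta> g \<in> Q}"
    then have g: "g \<in> elems G" "\<zeta> g \<in> Q" by auto
    obtain B where B: "open_bisection G B" "\<zeta> g \<in> B" "B \<subseteq> Q"
      using ex_open_bisection[OF Q g(2)] .
    obtain A' where "openin (gtop G) A'" "g \<in> A'" "\<zeta> ` A' \<subseteq> B"
      by (rule varsigma_local[OF bis_at[OF g(1)] B(1,2)]) blast
    then show "\<exists>V. openin (gtop G) V \<and> g \<in> V \<and> V \<subseteq> {g \<in> elems G. \<zeta> g \<in> Q}"
      using B(3) openin_subset by (intro exI[of _ A']) blast
  qed
  then show ?thesis using varsigma(1) by (auto simp: continuous_map_def)
qed

lemma varsigma_open: "open_map (gtop G) (gtop G) \<zeta>"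
  unfolding open_map_def
proof (intro allI impI, subst openin_subopen, intro ballI)
  fix U k assume U: "openin (gtop G) U" and "k \<in> \<zeta> ` U"
  then obtain g where g: "g \<in> U" "k = \<zeta> g" by blast
  then have gG: "g \<in> elems G" using U openin_subset by blast
  obtain A where A: "open_bisection G A" "g \<in> A" "A \<subseteq> U"
    using ex_open_bisection[OF U g(1)] .
  obtain A' where "openin (gtop G) (\<zeta> ` A')" "g \<in> A'" "A' \<subseteq> A"
    by (rule varsigma_local[OF A(1,2) bis_at[OF varsigma(1)[OF gG]]]) blast
  then show "\<exists>V. openin (gtop G) V \<and> k \<in> V \<and> V \<subseteq> \<zeta> ` U"
    using A(3) g(2) by (intro exI[of _ "\<zeta> ` A'"]) blast
qed

lemma varsigma_pow_in: "g \<in> elems G \<Longrightarrow> (\<zeta> ^^ n) g \<in> elems G"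
  by (induction n) (simp_all add: varsigma(1))

lemma s_varsigma_pow: "g \<in> elems G \<Longrightarrow> s ((\<zeta> ^^ n) g) = (shift ^^ n) (s g)"
  by (induction n) (simp_all add: s_varsigma varsigma_pow_in)

lemma r_varsigma_pow: "g \<in> elems G \<Longrightarrow> r ((\<zeta> ^^ n) g) = (shift ^^ n) (r g)"
  by (induction n) (simp_all add: r_varsigma varsigma_pow_in)

lemma varsigma_pow_continuous: "continuous_map (gtop G) (gtop G) (\<zeta> ^^ n)"
proof (induction n)
  case (Suc n)
  then show ?case using continuous_map_compose[OF Suc varsigma_continuous] by (simp add: o_def)
qed (simp add: id_def)

lemma openin_varsigma_pow: "openin (gtop G) U \<Longrightarrow> openin (gtop G) ((\<zeta> ^^ n) ` U)"
proof (induction n)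
  case (Suc n)
  then have "openin (gtop G) (\<zeta> ` (\<zeta> ^^ n) ` U)" using varsigma_open by (simp add: open_map_def)
  then show ?case by (simp add: image_comp)
qed simp

lemma compactin_varsigma_pow: "compactin (gtop G) C \<Longrightarrow> compactin (gtop G) ((\<zeta> ^^ n) ` C)"
  using image_compactin varsigma_pow_continuous by blast

section \<open>Cuts of bisections\<close>

definition slice :: "nat \<Rightarrow> (nat \<Rightarrow> 'a) \<Rightarrow> 'g set \<Rightarrow> 'g set" where
  "slice k a F = {g \<in> F. \<forall>i<k. s g i = a i}"

text \<open>
  Words are represented by sequences of which only a prefix matters: \<open>cut m 0 u v F\<close> is the
  bisection \<open>S\<^sub>v\<^sup>-\<^sup>1 F S\<^sub>u\<close> for words of length \<open>m\<close>, and \<open>cut n k u v F\<close> is the part of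
  \<open>S\<^sub>v\<^sup>-\<^sup>1 F S\<^sub>u\<close> whose source starts with the \<open>k\<close> letters of \<open>u\<close> after the first \<open>n\<close>.
\<close>

definition cut :: "nat \<Rightarrow> nat \<Rightarrow> (nat \<Rightarrow> 'a) \<Rightarrow> (nat \<Rightarrow> 'a) \<Rightarrow> 'g set \<Rightarrow> 'g set" where
  "cut n k a b F = (\<zeta> ^^ n) ` {g \<in> F. (\<forall>i<n + k. s g i = a i) \<and> (\<forall>i<n. r g i = b i)}"

lemma slice_empty [simp]: "slice k a {} = {}" and cut_empty [simp]: "cut n k a b {} = {}"
  by (simp_all add: slice_def cut_def)

lemma cut_0: "cut 0 k a b F = slice k a F"
  by (simp add: cut_def slice_def)

text \<open>For \<open>j \<le> n + k\<close> the slice only repeats conditions that the cut imposes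
  anyway.\<close>

lemma cut_slice_absorb: "j \<le> n + k \<Longrightarrow> cut n k a b (slice j a F) = cut n k a b F"
  unfolding cut_def slice_def by (rule arg_cong[of _ _ "image _"]) auto

text \<open>After \<open>n\<close> shifts the source letters are the original ones from position
  \<open>n\<close> on. The two prescriptions of \<open>j\<close> and \<open>k\<close> letters thus
  start at the same place, and the longer one prevails.\<close>

lemma slice_cut:
  assumes "F \<subseteq> elems G"
  shows "slice k ((shift ^^ n) a) (cut n j a b F) = cut n (max j k) a b F"
proof -
  have "{g \<in> F. ((\<forall>i<n + j. s g i = a i) \<and> (\<forall>i<n. r g i = b i)) \<and> (\<forall>i<k. s g (n + i) = a (n + i))}
    = {g \<in> F. (\<forall>i<n + max j k. s g i = a i) \<and> (\<forall>i<n. r g i = b i)}"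
    unfolding less_add_cases by (auto simp: less_max_iff_disj)
  moreover have "slice k ((shift ^^ n) a) (cut n j a b F) = (\<zeta> ^^ n) `
     {g \<in> F. ((\<forall>i<n + j. s g i = a i) \<and> (\<forall>i<n. r g i = b i)) \<and> (\<forall>i<k. s g (n + i) = a (n + i))}"
    using assms unfolding slice_def cut_def
    by (auto simp: s_varsigma_pow funpow_shift subset_iff)
  ultimately show ?thesis by (simp add: cut_def)
qed

text \<open>Cuts compose. The bound on \<open>j\<close> says that the spare letters of the inner cut
  are among those prescribed by the outer one, so they leave no trace in the result.\<close>

lemma cut_cut:
  assumes "F \<subseteq> elems G" and jk: "j \<le> m + k"
  shows "cut m k ((shift ^^ n) a) ((shift ^^ n) b) (cut n j a b F) = cut (n + m) k a b F"
proof -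
  have "{g \<in> F. ((\<forall>i<n + j. s g i = a i) \<and> (\<forall>i<n. r g i = b i)) \<and>
      (\<forall>i<m + k. s g (n + i) = a (n + i)) \<and> (\<forall>i<m. r g (n + i) = b (n + i))}
    = {g \<in> F. (\<forall>i<n + m + k. s g i = a i) \<and> (\<forall>i<n + m. r g i = b i)}"
    unfolding add.assoc[of n m k] less_add_cases[of n] using jk by auto
  moreover have "cut m k ((shift ^^ n) a) ((shift ^^ n) b) (cut n j a b F) = (\<zeta> ^^ m) ` (\<zeta> ^^ n) `
     {g \<in> F. ((\<forall>i<n + j. s g i = a i) \<and> (\<forall>i<n. r g i = b i)) \<and>
      (\<forall>i<m + k. s g (n + i) = a (n + i)) \<and> (\<forall>i<m. r g (n + i) = b (n + i))}"
    unfolding cut_def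
    by (rule arg_cong[of _ _ "image _"])
      (use assms in \<open>auto simp: s_varsigma_pow r_varsigma_pow funpow_shift subset_iff\<close>)
  ultimately show ?thesis
    by (simp add: cut_def image_comp funpow_add[symmetric] add.commute)
qed

lemma compact_open_bisection_elems: "compact_open_bisection G F \<Longrightarrow> F \<subseteq> elems G"
  by (simp add: compact_open_bisection_iff open_bisection_elems)

text \<open>Cylinders are clopen, so the selected part of \<open>F\<close> is compact and open, and
  \<open>\<zeta>\<close> is continuous and open. Injectivity survives because the deleted letters
  are prescribed and can be restored.\<close>

lemma compact_open_bisection_cut:
  assumes F: "compact_open_bisection G F"
  shows "compact_open_bisection G (cut n k a b F)"
proof -
  have FG: "F \<subseteq> elems G" and Fo: "openin (gtop G) F" and Fc: "compactin (gtop G) F"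
    and inj: "inj_on s F" "inj_on r F"
    using F compact_open_bisection_elems by (auto simp: compact_open_bisection_iff open_bisection_iff)
  define A where "A = {g \<in> F. (\<forall>i<n + k. s g i = a i) \<and> (\<forall>i<n. r g i = b i)}"
  have A1: "A = {g \<in> {g \<in> F. s g \<in> cyl E (n + k) a}. r g \<in> cyl E n b}"
    using FG s_in r_in by (auto simp: A_def cyl_def)
  have A2: "A = {g \<in> elems G. s g \<in> cyl E (n + k) a} \<inter> ({g \<in> elems G. r g \<in> cyl E n b} \<inter> F)"
    using FG by (auto simp: A1)
  have cl: "closedin E (cyl E j c)" "openin E (cyl E j c)" for j c
    unfolding E_eq by (rule clopen_cyl)+
  have Ao: "openin (gtop G) A" unfolding A1
    by (intro openin_s_preimage openin_r_preimage Fo cl)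
  have Ac: "compactin (gtop G) A" unfolding A2
    by (intro closed_Int_compactin Fc closedin_continuous_map_preimage[OF s_continuous cl(1)]
        closedin_continuous_map_preimage[OF r_continuous cl(1)])
  have sh: "w = w'" if "(shift ^^ n) w = (shift ^^ n) w'" "\<forall>i<n. w i = w' i" for w w' :: "nat \<Rightarrow> 'a"
  proof
    fix i show "w i = w' i"
      using that(2) fun_cong[OF that(1), of "i - n"] by (cases "i < n") (simp_all add: funpow_shift)
  qed
  have "inj_on s ((\<zeta> ^^ n) ` A)"
  proof (rule inj_onI, clarify)
    fix g h assume gh: "g \<in> A" "h \<in> A" "s ((\<zeta> ^^ n) g) = s ((\<zeta> ^^ n) h)"
    have gG: "g \<in> elems G" "h \<in> elems G" using gh FG unfolding A_def by blast+
    have "s g = s h"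
    proof (rule sh)
      show "(shift ^^ n) (s g) = (shift ^^ n) (s h)"
        using gh(3) by (simp only: s_varsigma_pow gG)
      show "\<forall>i<n. s g i = s h i" using gh(1,2) by (simp add: A_def)
    qed
    then show "(\<zeta> ^^ n) g = (\<zeta> ^^ n) h" using gh inj(1) by (auto simp: A_def dest: inj_onD)
  qed
  moreover have "inj_on r ((\<zeta> ^^ n) ` A)"
  proof (rule inj_onI, clarify)
    fix g h assume gh: "g \<in> A" "h \<in> A" "r ((\<zeta> ^^ n) g) = r ((\<zeta> ^^ n) h)"
    have gG: "g \<in> elems G" "h \<in> elems G" using gh FG unfolding A_def by blast+
    have "r g = r h"
    proof (rule sh)
      show "(shift ^^ n) (r g) = (shift ^^ n) (r h)"
        using gh(3) by (simp only: r_varsigma_pow gG)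
      show "\<forall>i<n. r g i = r h i" using gh(1,2) by (simp add: A_def)
    qed
    then show "(\<zeta> ^^ n) g = (\<zeta> ^^ n) h" using gh inj(2) by (auto simp: A_def dest: inj_onD)
  qed
  ultimately show ?thesis
    using openin_varsigma_pow[OF Ao] compactin_varsigma_pow[OF Ac]
    by (simp add: compact_open_bisection_iff open_bisection_iff cut_def A_def)
qed

text \<open>Elements over the same source in two bisections with equal partial maps have equal
  germs, hence coincide. Membership in the image of \<open>\<N>\<close> under
  \<open>bis_map G e\<close> thereby becomes membership in \<open>\<N>\<close>.\<close>

lemma bis_map_inj:
  assumes H: "open_bisection G H" and K: "open_bisection G K" and eq: "bis_map G e H = bis_map G e K"
  shows "H = K"
proof -
  have "H \<subseteq> K" if H: "open_bisection G H" and K: "open_bisection G K"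
    and eq: "bis_map G e H = bis_map G e K" for H K
  proof
    fix g assume g: "g \<in> H"
    then have "(s g, r g) \<in> bis_map G e H" by (auto simp: bis_map_iff)
    then obtain k where k: "k \<in> K" "s k = s g" unfolding eq bis_map_iff by blast
    have "g = k"
    proof (rule elem_germ_inj)
      show "g \<in> elems G" "k \<in> elems G" using g k H K open_bisection_elems by auto
      show "elem_germ E G e g = elem_germ E G e k"
        using elem_germ_eq[OF H g] elem_germ_eq[OF K k(1)] k(2) eq by simp
    qed
    then show "g \<in> K" using k by simp
  qed
  then show ?thesis using assms by blast
qed

text \<open>Only \<open>n + k\<close> letters of \<open>a\<close> and \<open>n\<close> letters of
  \<open>b\<close> matter, and in a nonempty cut they are letters of actual sequences, hence belong
  to the finite alphabet.\<close>

lemma finite_cuts: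
  assumes "F \<subseteq> elems G" shows "finite {cut n k a b F | a b. True}"
proof (rule finite_subset)
  \<comment> \<open>A word becomes a sequence through \<open>(!)\<close>; its values beyond the
    length are never inspected.\<close>
  let ?f = "\<lambda>(u, v). cut n k ((!) u) ((!) v) F"
  show "finite (insert {} (?f ` (words X (n + k) \<times> words X n)))"
    using finite_X finite_words by blast
  show "{cut n k a b F | a b. True} \<subseteq> insert {} (?f ` (words X (n + k) \<times> words X n))"
  proof clarsimp
    fix a b
    assume ni: "cut n k a b F \<notin> ?f ` (words X (n + k) \<times> words X n)"
    show "cut n k a b F = {}"
    proof (rule ccontr)
      assume "cut n k a b F \<noteq> {}"
      then obtain g where g: "g \<in> F" "\<forall>i<n + k. s g i = a i" "\<forall>i<n. r g i = b i"
        by (auto simp: cut_def)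
      then have gG: "g \<in> elems G" using assms by blast
      define u v where "u = map a [0..<n + k]" and "v = map b [0..<n]"
      have "s g i \<in> X" "r g i \<in> X" for i
        using s_in[OF gG] r_in[OF gG] by (auto simp: topspace_E markov_chain_def)
      then have "u \<in> words X (n + k)" "v \<in> words X n"
        using g by (auto simp: u_def v_def words_def) (metis)+
      moreover have "cut n k a b F = cut n k ((!) u) ((!) v) F"
        by (simp add: cut_def u_def v_def)
      ultimately show False using ni by blast
    qed
  qed
qed

text \<open>Read from the longer sequence: all intermediate suffixes lie in the space automatically,
  because it is closed under \<open>shift\<close>.\<close>

lemma S_word_iff:
  "(w, w') \<in> S_word E v \<longleftrightarrow> w' \<in> topspace E \<and> (\<forall>i<length v. w' i = v ! i) \<and>
     w = (shift ^^ length v) w'"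
proof (induction v arbitrary: w')
  case Nil
  then show ?case by auto
next
  case (Cons x v)
  have "(w, w') \<in> S_word E (x # v) \<longleftrightarrow> w' \<in> topspace E \<and> w' 0 = x \<and> (w, shift w') \<in> S_word E v"
  proof
    assume "(w, w') \<in> S_word E (x # v)"
    then show "w' \<in> topspace E \<and> w' 0 = x \<and> (w, shift w') \<in> S_word E v"
      by (auto simp: S_letter_def)
  next
    assume R: "w' \<in> topspace E \<and> w' 0 = x \<and> (w, shift w') \<in> S_word E v"
    then have "(shift w', w') \<in> S_letter E x"
      using case_nat_shift[of w'] shift_in by (auto simp: S_letter_def)
    then show "(w, w') \<in> S_word E (x # v)" using R by auto
  qed
  also have "\<dots> \<longleftrightarrow> w' \<in> topspace E \<and> (\<forall>i<length (x # v). w' i = (x # v) ! i) \<and>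
     w = (shift ^^ length (x # v)) w'"
    unfolding Cons.IH using shift_in[of w', unfolded shift_def]
    by (auto simp: All_less_Suc2 shift_def[of w'] funpow_swap1 fun_eq_iff funpow_shift)
  finally show ?case .
qed

text \<open>The bridge between condition (3) and cuts: \<open>v2\<close> prescribes the source and
  \<open>v1\<close> the range.\<close>

lemma conj_words:
  assumes "U \<subseteq> elems G" "length v1 = m" "length v2 = m"
  shows "S_word E v2 O bis_map G e U O converse (S_word E v1)
    = bis_map G e (cut m 0 ((!) v2) ((!) v1) U)"
proof (rule set_eqI, clarify)
  fix w w'
  have "(w, w') \<in> S_word E v2 O bis_map G e U O converse (S_word E v1) \<longleftrightarrow>
    (\<exists>g\<in>U. (w, s g) \<in> S_word E v2 \<and> (w', r g) \<in> S_word E v1)"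
    by (auto simp: bis_map_def)
  also have "\<dots> \<longleftrightarrow> (\<exists>g\<in>U. (\<forall>i<m. s g i = v2 ! i) \<and> (\<forall>i<m. r g i = v1 ! i) \<and>
      w = (shift ^^ m) (s g) \<and> w' = (shift ^^ m) (r g))"
    unfolding S_word_iff using assms s_in r_in by (intro bex_cong refl) auto
  also have "\<dots> \<longleftrightarrow> (w, w') \<in> bis_map G e (cut m 0 ((!) v2) ((!) v1) U)"
    unfolding bis_map_iff cut_def using assms(1)
    by (auto simp: s_varsigma_pow r_varsigma_pow subset_iff)
  finally show "(w, w') \<in> S_word E v2 O bis_map G e U O converse (S_word E v1) \<longleftrightarrow>
    (w, w') \<in> bis_map G e (cut m 0 ((!) v2) ((!) v1) U)" .
qed

section \<open>Compact open bisections and uniform slicing\<close>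

lemma compact_E: "compact_space E"
  unfolding E_eq using finite_X by (rule compact_markov_space)

text \<open>Restrict an open bisection to the part over a cylinder inside its source set. Covers are
  pushed down to this compact cylinder by the open map \<open>s\<close>, and a finite subcover is
  pulled back by injectivity.\<close>

lemma ex_compact_open_bisection:
  assumes "openin (gtop G) Q" "g \<in> Q"
  obtains H where "compact_open_bisection G H" "g \<in> H" "H \<subseteq> Q"
proof -
  obtain U where U: "open_bisection G U" "g \<in> U" "U \<subseteq> Q"
    using ex_open_bisection[OF assms] .
  then have Uo: "openin (gtop G) U" and inj: "inj_on s U"
    by (auto simp: open_bisection_iff)
  have gG: "g \<in> elems G" using U open_bisection_elems by blast
  obtain k where k: "cyl E k (s g) \<subseteq> s ` U"
    using cyl_base[of X T "s ` U" "s g"] openin_s_image[OF Uo] U(2) by (auto simp: E_eq)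
  define H where "H = {u \<in> U. s u \<in> cyl E k (s g)}"
  have cl: "closedin E (cyl E k (s g))" "openin E (cyl E k (s g))"
    unfolding E_eq by (rule clopen_cyl)+
  have Ho: "openin (gtop G) H" unfolding H_def by (rule openin_s_preimage[OF Uo cl(2)])
  have cc: "compactin E (cyl E k (s g))" using closedin_compact_space compact_E cl(1) by blast
  have "compactin (gtop G) H"
    unfolding compactin_def
  proof (intro conjI allI impI)
    show "H \<subseteq> elems G" using Ho by (rule openin_subset)
    fix \<U> assume \<U>: "(\<forall>V\<in>\<U>. openin (gtop G) V) \<and> H \<subseteq> \<Union>\<U>"
    let ?f = "\<lambda>V. s ` (V \<inter> H)"
    have "cyl E k (s g) \<subseteq> \<Union>(?f ` \<U>)"
    proof
      fix w assume w: "w \<in> cyl E k (s g)"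
      then obtain u where u: "u \<in> U" "w = s u" using k by blast
      then have "u \<in> H" using w by (simp add: H_def)
      then obtain V where "V \<in> \<U>" "u \<in> V" using \<U> by (meson UnionE in_mono)
      then show "w \<in> \<Union>(?f ` \<U>)" using \<open>u \<in> H\<close> u(2) by (intro UN_I[of V]) simp_all
    qed
    moreover have "openin E W" if W: "W \<in> ?f ` \<U>" for W
    proof -
      obtain V where "V \<in> \<U>" "W = s ` (V \<inter> H)" using W by (rule imageE)
      then show ?thesis using \<U> Ho by (simp add: openin_s_image openin_Int)
    qed
    ultimately have "\<exists>\<F>. finite \<F> \<and> \<F> \<subseteq> ?f ` \<U> \<and> cyl E k (s g) \<subseteq> \<Union>\<F>"
      by (intro compactinD[OF cc])
    then obtain \<F> where F: "finite \<F>" "\<F> \<subseteq> ?f ` \<U>" "cyl E k (s g) \<subseteq> \<Union>\<F>" by iprover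
    obtain \<F>' where F': "\<F>' \<subseteq> \<U>" "finite \<F>'" "\<F> = ?f ` \<F>'"
      using finite_subset_image[OF F(1,2)] by iprover
    have "H \<subseteq> \<Union>\<F>'"
    proof
      fix h assume h: "h \<in> H"
      then have "s h \<in> \<Union>(?f ` \<F>')" using F(3) unfolding F'(3) H_def by (simp add: subset_iff)
      then obtain V where V: "V \<in> \<F>'" "s h \<in> s ` (V \<inter> H)" by (rule UN_E)
      then obtain v where v: "v \<in> V" "v \<in> H" "s h = s v" by blast
      then have "h = v" using h inj by (auto simp: H_def dest: inj_onD)
      then show "h \<in> \<Union>\<F>'" using v V(1) by blast
    qed
    then show "\<exists>\<F>. finite \<F> \<and> \<F> \<subseteq> \<U> \<and> H \<subseteq> \<Union>\<F>" using F' by blast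
  qed
  moreover have "open_bisection G H"
    using open_bisection_subset[OF U(1) Ho] by (auto simp: H_def)
  ultimately have "compact_open_bisection G H" by (simp add: compact_open_bisection_iff)
  moreover have "g \<in> H" using U(2) s_in[OF gG] by (simp add: H_def cyl_def)
  moreover have "H \<subseteq> Q" using U(3) by (auto simp: H_def)
  ultimately show ?thesis by (rule that)
qed

lemma compactin_cover:
  assumes "compactin (gtop G) C" "openin (gtop G) Q" "C \<subseteq> Q"
  obtains \<F> where "finite \<F>" "\<forall>F\<in>\<F>. compact_open_bisection G F" "C \<subseteq> \<Union>\<F>" "\<Union>\<F> \<subseteq> Q"
proof -
  let ?U = "{H. compact_open_bisection G H \<and> H \<subseteq> Q}"
  have "C \<subseteq> \<Union>?U" using ex_compact_open_bisection[OF assms(2)] assms(3) by blast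
  moreover have "\<And>V. V \<in> ?U \<Longrightarrow> openin (gtop G) V" by (auto simp: compact_open_bisection_def)
  ultimately obtain \<F> where "finite \<F>" "\<F> \<subseteq> ?U" "C \<subseteq> \<Union>\<F>"
    using compactinD[OF assms(1), of ?U] by blast
  then show ?thesis by (intro that[of \<F>]) auto
qed

text \<open>Pointwise on sources: outside the closed set of sources of \<open>H\<close> a small
  cylinder misses it; at the source of an element of \<open>H \<inter> F\<close> the two bisections
  coincide over a small cylinder. Compactness of \<open>E\<close> makes the length uniform.\<close>

lemma uniform_slice:
  assumes H: "compact_open_bisection G H" and F: "\<forall>F\<in>\<F>. compact_open_bisection G F"
    and sub: "H \<subseteq> \<Union>\<F>"
  obtains k where "\<forall>l\<ge>k. \<forall>c. slice l c H = {} \<or> (\<exists>F\<in>\<F>. slice l c H = slice l c F)"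
proof -
  define Q where "Q l c \<longleftrightarrow> slice l c H = {} \<or> (\<exists>F\<in>\<F>. slice l c H = slice l c F)" for l c
  have mono: "Q l c" if "Q k c" "k \<le> l" for k l c
  proof -
    have "slice l c A = slice l c (slice k c A)" for A using \<open>k \<le> l\<close> by (auto simp: slice_def)
    then show ?thesis using \<open>Q k c\<close> unfolding Q_def by (metis slice_empty)
  qed
  have cong: "slice l c = slice l c'" if "\<forall>i<l. c i = c' i" for l c c'
    using that by (auto simp: slice_def fun_eq_iff)
  have Ho: "open_bisection G H" "openin (gtop G) H" and Hc: "compactin (gtop G) H"
    using H by (auto simp: compact_open_bisection_iff open_bisection_iff)
  have HG: "H \<subseteq> elems G" using H by (rule compact_open_bisection_elems)
  have ex: "\<exists>k. Q k x" if x: "x \<in> topspace E" for x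
  proof (cases "x \<in> s ` H")
    case False
    have "closedin E (s ` H)"
      using compactin_imp_closedin[OF _ image_compactin[OF Hc s_continuous]]
        Hausdorff_markov_space E_eq by blast
    then obtain k where k: "cyl E k x \<subseteq> topspace E - s ` H"
      using cyl_base[of X T "topspace E - s ` H" x] False x by (auto simp: E_eq)
    have "g \<notin> slice k x H" for g
    proof
      assume "g \<in> slice k x H"
      then have "g \<in> H" "s g \<in> cyl E k x" using HG s_in by (auto simp: slice_def cyl_def)
      then show False using k by blast
    qed
    then have "Q k x" by (auto simp: Q_def)
    then show ?thesis by blast
  next
    case True
    then obtain g F where g: "g \<in> H" "s g = x" "F \<in> \<F>" "g \<in> F" using sub by blast
    have Fo: "open_bisection G F" "openin (gtop G) F"
      using F g(3) by (auto simp: compact_open_bisection_iff open_bisection_iff)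
    have o: "openin E (s ` (H \<inter> F))" using Ho Fo by (intro openin_s_image openin_Int)
    have xs: "x \<in> s ` (H \<inter> F)" using g by blast
    obtain k where k: "cyl E k x \<subseteq> s ` (H \<inter> F)"
      using cyl_base[OF o[unfolded E_eq] xs] unfolding E_eq by blast
    have *: "slice k x A \<subseteq> B"
      if A: "open_bisection G A" and AB: "cyl E k x \<subseteq> s ` (A \<inter> B)" for A B
    proof
      fix h assume h: "h \<in> slice k x A"
      then have "s h \<in> cyl E k x"
        using open_bisection_elems[OF A] s_in by (auto simp: slice_def cyl_def)
      then obtain h' where "h' \<in> A" "h' \<in> B" "s h = s h'" using AB by blast
      moreover have "inj_on s A" using A by (simp add: open_bisection_iff)
      ultimately show "h \<in> B" using h by (auto simp: slice_def dest: inj_onD)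
    qed
    have "slice k x H \<subseteq> F" by (rule *[OF Ho(1) k])
    moreover have "slice k x F \<subseteq> H" using k by (intro *[OF Fo(1)]) (simp add: Int_commute)
    ultimately have "slice k x H = slice k x F" by (auto simp: slice_def)
    then have "Q k x" using g(3) by (auto simp: Q_def)
    then show ?thesis by blast
  qed
  \<comment> \<open>\<open>Q k x\<close> depends only on the first \<open>k\<close> letters of
    \<open>x\<close>, so this set is a union of cylinders.\<close>
  have Qo: "openin E {x \<in> topspace E. Q k x}" for k
  proof (subst openin_subopen, intro ballI)
    fix x assume x: "x \<in> {x \<in> topspace E. Q k x}"
    have "cyl E k x \<subseteq> {x \<in> topspace E. Q k x}"
    proof
      fix y assume y: "y \<in> cyl E k x"
      then have "slice k x = slice k y" by (intro cong) (simp add: cyl_def)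
      then show "y \<in> {x \<in> topspace E. Q k x}" using x y by (simp add: Q_def cyl_def)
    qed
    then show "\<exists>V. openin E V \<and> x \<in> V \<and> V \<subseteq> {x \<in> topspace E. Q k x}"
      using clopen_cyl(1)[of X T k x] x by (auto simp: E_eq cyl_def)
  qed
  have "topspace E \<subseteq> (\<Union>k. {x \<in> topspace E. Q k x})" using ex by blast
  from compactin_subset_UN_atMost[OF compact_E[unfolded compact_space_def] Qo this]
  obtain K where K: "topspace E \<subseteq> (\<Union>k\<le>K. {x \<in> topspace E. Q k x})" .
  show ?thesis
  proof (rule that, intro allI impI)
    fix l c assume l: "K \<le> l"
    show "slice l c H = {} \<or> (\<exists>F\<in>\<F>. slice l c H = slice l c F)"
    proof (cases "slice l c H = {}")
      \<comment> \<open>The sequence \<open>c\<close> is arbitrary, possibly outside the space; the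
        source of an element of the slice replaces it.\<close>
      case False
      then obtain g where g: "g \<in> H" "\<forall>i<l. s g i = c i" by (auto simp: slice_def)
      then have "s g \<in> (\<Union>k\<le>K. {x \<in> topspace E. Q k x})" using K s_in HG by blast
      then obtain k where "k \<le> K" "Q k (s g)" by blast
      then have "Q l (s g)" using mono[of k "s g" l] l by simp
      then show ?thesis using cong[OF g(2)] by (simp add: Q_def)
    qed simp
  qed
qed

lemma uniform_slice_finite:
  assumes "finite \<H>" and H: "\<forall>H\<in>\<H>. compact_open_bisection G H"
    and F: "\<forall>F\<in>\<F>. compact_open_bisection G F" and sub: "\<Union>\<H> \<subseteq> \<Union>\<F>"
  obtains k where
    "\<forall>H\<in>\<H>. \<forall>l\<ge>k. \<forall>c. slice l c H = {} \<or> (\<exists>F\<in>\<F>. slice l c H = slice l c F)"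
proof -
  define Q where "Q H l \<longleftrightarrow> (\<forall>c. slice l c H = {} \<or> (\<exists>F\<in>\<F>. slice l c H = slice l c F))" for H l
  have "\<forall>H\<in>\<H>. \<exists>k. \<forall>l\<ge>k. Q H l"
  proof
    fix H assume "H \<in> \<H>"
    then have "compact_open_bisection G H" "H \<subseteq> \<Union>\<F>" using H sub by auto
    from uniform_slice[OF this(1) F this(2)]
    obtain k where "\<forall>l\<ge>k. \<forall>c. slice l c H = {} \<or> (\<exists>F\<in>\<F>. slice l c H = slice l c F)" .
    then show "\<exists>k. \<forall>l\<ge>k. Q H l" unfolding Q_def by blast
  qed
  from bchoice[OF this] obtain k where k: "\<forall>H\<in>\<H>. \<forall>l\<ge>k H. Q H l" ..
  obtain K where K: "\<forall>n\<in>k ` \<H>. n \<le> K"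
    using finite_imageI[OF assms(1)] finite_nat_set_iff_bounded_le by blast
  have "Q H l" if "H \<in> \<H>" "K \<le> l" for H l
  proof -
    have "k H \<le> l" using K that by (meson imageI le_trans)
    then show ?thesis using k that(1) by blast
  qed
  then show ?thesis unfolding Q_def by (intro that[of K]) blast
qed

section \<open>Existence and uniqueness of nuclei\<close>

lemma varsigma_pow_image_add: "(\<zeta> ^^ (m + n)) ` D = (\<zeta> ^^ m) ` (\<zeta> ^^ n) ` D"
  by (simp add: funpow_add image_comp)

lemma varsigma_pow_invariant: "\<zeta> ` D \<subseteq> D \<Longrightarrow> (\<zeta> ^^ n) ` D \<subseteq> D"
  by (induction n) auto

lemma varsigma_pow_antimono: "\<zeta> ` D \<subseteq> D \<Longrightarrow> m \<le> n \<Longrightarrow> (\<zeta> ^^ n) ` D \<subseteq> (\<zeta> ^^ m) ` D"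
  using varsigma_pow_invariant[of D "n - m"] varsigma_pow_image_add[of m "n - m" D]
  by (metis image_mono le_add_diff_inverse)

lemma openin_varsigma_pow_preimage:
  "openin (gtop G) U \<Longrightarrow> openin (gtop G) {g \<in> elems G. (\<zeta> ^^ n) g \<in> U}"
  by (rule openin_continuous_map_preimage[OF varsigma_pow_continuous])

lemma absorbing_compactin:
  assumes D: "openin (gtop G) D" "absorbing E G e D" and C: "compactin (gtop G) C"
  obtains K where "\<forall>g\<in>C. \<exists>n\<le>K. (\<zeta> ^^ n) g \<in> D"
proof -
  have "C \<subseteq> (\<Union>n. {g \<in> elems G. (\<zeta> ^^ n) g \<in> D})"
    using D(2) compactin_subset_topspace[OF C] by (auto simp: absorbing_def)
  from compactin_subset_UN_atMost[OF C openin_varsigma_pow_preimage[OF D(1)] this]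
  obtain K where "C \<subseteq> (\<Union>n\<le>K. {g \<in> elems G. (\<zeta> ^^ n) g \<in> D})" .
  then show ?thesis by (intro that[of K]) blast
qed

text \<open>An orbit that has entered \<open>D\<close> stays there, so a bound on the entry times is
  itself a common entry time.\<close>

lemma absorbing_invariant_compactin:
  assumes D: "openin (gtop G) D" "absorbing E G e D" "\<zeta> ` D \<subseteq> D" and C: "compactin (gtop G) C"
  obtains K where "(\<zeta> ^^ K) ` C \<subseteq> D"
proof -
  obtain K where K: "\<forall>g\<in>C. \<exists>n\<le>K. (\<zeta> ^^ n) g \<in> D"
    using absorbing_compactin[OF D(1,2) C] .
  have "(\<zeta> ^^ K) g \<in> D" if g: "g \<in> C" for g
  proof -
    obtain n where n: "n \<le> K" "(\<zeta> ^^ n) g \<in> D" using K g by blast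
    have "(\<zeta> ^^ (K - n)) ((\<zeta> ^^ n) g) \<in> D"
      using n(2) by (rule subsetD[OF varsigma_pow_invariant[OF D(3)], OF imageI])
    then show ?thesis using n(1) by (metis comp_apply funpow_add le_add_diff_inverse2)
  qed
  then show ?thesis by (intro that[of K] image_subsetI)
qed

text \<open>A finite cover enlarges \<open>C\<close> to a compact open \<open>B\<close>. Return
  times to \<open>B\<close> are bounded, and the union of sufficiently many images of
  \<open>B\<close> is then invariant.\<close>

lemma ex_absorbing_invariant:
  assumes C: "compactin (gtop G) C" "absorbing E G e C"
  obtains D where "compactin (gtop G) D" "openin (gtop G) D" "absorbing E G e D" "\<zeta> ` D \<subseteq> D"
proof -
  obtain \<F> where F: "finite \<F>" "\<forall>F\<in>\<F>. compact_open_bisection G F" "C \<subseteq> \<Union>\<F>"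
    using compactin_cover[OF C(1) openin_topspace compactin_subset_topspace[OF C(1)]] .
  define B where "B = \<Union>\<F>"
  have Bc: "compactin (gtop G) B" and Bo: "openin (gtop G) B" unfolding B_def
    using F by (auto simp: compact_open_bisection_def intro!: compactin_Union)
  have Ba: "absorbing E G e B" using C(2) F(3) unfolding absorbing_def B_def by blast
  \<comment> \<open>Counted from the image of \<open>B\<close>, so that the return takes at least
    one step.\<close>
  obtain K where K: "\<forall>g\<in>(\<zeta> ^^ 1) ` B. \<exists>n\<le>K. (\<zeta> ^^ n) g \<in> B"
    using absorbing_compactin[OF Bo Ba compactin_varsigma_pow[OF Bc]] .
  define D where "D = (\<Union>i\<le>K. (\<zeta> ^^ i) ` B)"
  show ?thesis
  proof
    show "compactin (gtop G) D" unfolding D_def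
      by (intro compactin_Union) (auto intro: compactin_varsigma_pow Bc)
    show "openin (gtop G) D" unfolding D_def
      by (intro openin_Union) (auto intro: openin_varsigma_pow Bo)
    have "B \<subseteq> D" unfolding D_def by (intro subsetI UN_I[of 0]) simp_all
    then show "absorbing E G e D" using Ba unfolding absorbing_def by blast
    show "\<zeta> ` D \<subseteq> D"
    proof clarify
      fix d assume "d \<in> D"
      then obtain i b where b: "i \<le> K" "b \<in> B" "d = (\<zeta> ^^ i) b" unfolding D_def by blast
      show "\<zeta> d \<in> D"
      proof (cases "i = K")
        case False
        then have "Suc i \<le> K" "\<zeta> d = (\<zeta> ^^ Suc i) b" using b by auto
        then show ?thesis unfolding D_def using b(2) by blast
      next
        case True
        \<comment> \<open>From \<open>\<zeta> b\<close> the orbit reaches \<open>B\<close> after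
          \<open>n\<close> steps; the remaining \<open>K - n\<close> steps place
          \<open>\<zeta> d\<close> in an earlier image of \<open>B\<close>.\<close>
        obtain n where n: "n \<le> K" "(\<zeta> ^^ n) (\<zeta> b) \<in> B" using K b(2) by auto
        have "\<zeta> d = (\<zeta> ^^ K) (\<zeta> b)" using b(3) True by (simp add: funpow_swap1)
        also have "\<dots> = (\<zeta> ^^ (K - n)) ((\<zeta> ^^ n) (\<zeta> b))"
          using n(1) by (metis comp_apply funpow_add le_add_diff_inverse2)
        finally have "\<zeta> d \<in> (\<zeta> ^^ (K - n)) ` B" using n(2) by blast
        moreover have "K - n \<le> K" by simp
        ultimately show ?thesis unfolding D_def by blast
      qed
    qed
  qed
qed

text \<open>
  A cut of depth \<open>n\<close> with \<open>l\<close> letters to spare is again a slice of a member of the cover, for all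
  \<open>n\<close> at once. This is what makes the set of deep cuts finite.
\<close>

lemma cut_uniform:
  assumes F: "finite \<F>" "\<forall>F\<in>\<F>. compact_open_bisection G F" and inv: "\<zeta> ` \<Union>\<F> \<subseteq> \<Union>\<F>"
  obtains k where "\<forall>F\<in>\<F>. \<forall>l\<ge>k. \<forall>n a b.
    cut n l a b F = {} \<or> (\<exists>F'\<in>\<F>. cut n l a b F = slice l ((shift ^^ n) a) F')"
proof -
  \<comment> \<open>All one-step cuts of the cover: finitely many, and still covered by
    \<open>\<F>\<close> by invariance.\<close>
  let ?H = "\<Union>F\<in>\<F>. {cut 1 0 a b F | a b. True}"
  have FG: "F \<subseteq> elems G" if "F \<in> \<F>" for F using F that compact_open_bisection_elems by blast
  have fin: "finite ?H" using F(1) FG finite_cuts by blast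
  have cob: "\<forall>H\<in>?H. compact_open_bisection G H" using F(2) compact_open_bisection_cut by blast
  have "cut 1 0 a b F \<subseteq> \<zeta> ` \<Union>\<F>" if "F \<in> \<F>" for a b F
    using that by (auto simp: cut_def)
  then have "\<Union>?H \<subseteq> \<Union>\<F>" using inv by blast
  from uniform_slice_finite[OF fin cob F(2) this] obtain k where
    k: "\<forall>H\<in>?H. \<forall>l\<ge>k. \<forall>c. slice l c H = {} \<or> (\<exists>F\<in>\<F>. slice l c H = slice l c F)" .
  have "cut n l a b F = {} \<or> (\<exists>F'\<in>\<F>. cut n l a b F = slice l ((shift ^^ n) a) F')"
    if "F \<in> \<F>" "k \<le> l" for n F a b l
    using that
  proof (induction n arbitrary: l)
    case 0
    then show ?case by (auto simp: cut_0)
  next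
    case (Suc n)
    define a' b' where "a' = (shift ^^ n) a" and "b' = (shift ^^ n) b"
    \<comment> \<open>The last step uses up one of the \<open>1 + l\<close> spare letters, leaving
      \<open>l\<close>.\<close>
    have eq: "cut (Suc n) l a b F = cut 1 l a' b' (cut n (1 + l) a b F)"
      using cut_cut[OF FG[OF Suc.prems(1)], of "1 + l" 1 l n a b] by (simp add: a'_def b'_def)
    have "k \<le> 1 + l" using Suc.prems by simp
    from Suc.IH[OF Suc.prems(1) this] show ?case
    proof
      assume "cut n (1 + l) a b F = {}"
      then show ?thesis unfolding eq by simp
    next
      assume "\<exists>F'\<in>\<F>. cut n (1 + l) a b F = slice (1 + l) ((shift ^^ n) a) F'"
      then obtain F' where F': "F' \<in> \<F>" "cut n (1 + l) a b F = slice (1 + l) a' F'"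
        by (auto simp: a'_def)
      have "cut (Suc n) l a b F = cut 1 l a' b' F'"
        unfolding eq F'(2) by (rule cut_slice_absorb) simp
      also have "\<dots> = slice l (shift a') (cut 1 0 a' b' F')"
        using slice_cut[OF FG[OF F'(1)], of l 1 a' 0 b'] by simp
      finally have "cut (Suc n) l a b F = slice l ((shift ^^ Suc n) a) (cut 1 0 a' b' F')"
        by (simp add: a'_def)
      moreover have "cut 1 0 a' b' F' \<in> ?H" using F'(1) by blast
      ultimately show ?thesis using k[rule_format, OF _ Suc.prems(2)] by simp
    qed
  qed
  then show ?thesis by (intro that[of k]) blast
qed

text \<open>After all but the last \<open>k\<close> steps a cut of a cover member is, by
  \<open>cut_uniform\<close>, empty or a slice of a member, so the last \<open>k\<close> steps
  produce one of finitely many sets. An arbitrary \<open>H\<close> first flows into \<open>D\<close>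
  and is then compared with the cover.\<close>

lemma finite_deep_cuts:
  assumes D: "compactin (gtop G) D" "openin (gtop G) D" "absorbing E G e D" "\<zeta> ` D \<subseteq> D"
  obtains \<N> where "finite \<N>" "{} \<in> \<N>" "\<forall>H\<in>\<N>. compact_open_bisection G H"
    "\<forall>H. compact_open_bisection G H \<longrightarrow> (\<exists>n. \<forall>m\<ge>n. \<forall>a b. cut m 0 a b H \<in> \<N>)"
proof -
  obtain \<F> where F: "finite \<F>" "\<forall>F\<in>\<F>. compact_open_bisection G F" "D \<subseteq> \<Union>\<F>" "\<Union>\<F> \<subseteq> D"
    using compactin_cover[OF D(1,2) subset_refl] .
  then have DF: "\<Union>\<F> = D" by blast
  have FG: "F \<subseteq> elems G" if "F \<in> \<F>" for F using F that compact_open_bisection_elems by blast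
  have "\<zeta> ` \<Union>\<F> \<subseteq> \<Union>\<F>" using D(4) by (simp only: DF)
  then obtain k where k: "\<forall>F\<in>\<F>. \<forall>l\<ge>k. \<forall>n a b.
    cut n l a b F = {} \<or> (\<exists>F'\<in>\<F>. cut n l a b F = slice l ((shift ^^ n) a) F')"
    by (rule cut_uniform[OF F(1,2)])
  define \<N> where "\<N> = insert {} (\<Union>F\<in>\<F>. {cut k 0 a b F | a b. True})"
  have deep: "cut p 0 a b F \<in> \<N>" if "F \<in> \<F>" "k \<le> p" for F p a b
  proof -
    define q where "q = p - k"
    have p: "p = q + k" using that by (simp add: q_def)
    define a' b' where "a' = (shift ^^ q) a" and "b' = (shift ^^ q) b"
    \<comment> \<open>The \<open>k\<close> spare letters of the inner cut are exactly the source
      letters deleted by the outer one.\<close>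
    have eq: "cut p 0 a b F = cut k 0 a' b' (cut q k a b F)"
      using cut_cut[OF FG[OF that(1)], of k k 0 q a b] by (simp add: a'_def b'_def p)
    have "cut q k a b F = {} \<or> (\<exists>F'\<in>\<F>. cut q k a b F = slice k ((shift ^^ q) a) F')"
      using k that(1) by blast
    then show ?thesis
    proof
      assume "cut q k a b F = {}" then show ?thesis unfolding eq by (simp add: \<N>_def)
    next
      assume "\<exists>F'\<in>\<F>. cut q k a b F = slice k ((shift ^^ q) a) F'"
      then obtain F' where F': "F' \<in> \<F>" "cut q k a b F = slice k a' F'" by (auto simp: a'_def)
      then have "cut p 0 a b F = cut k 0 a' b' F'"
        unfolding eq F'(2) by (intro cut_slice_absorb) simp
      then show ?thesis using F'(1) by (auto simp: \<N>_def)
    qed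
  qed
  show ?thesis
  proof (rule that)
    show "finite \<N>" unfolding \<N>_def using F(1) FG finite_cuts by blast
    show "{} \<in> \<N>" by (simp add: \<N>_def)
    have "compact_open_bisection G {}"
      by (simp add: compact_open_bisection_iff open_bisection_iff)
    then show "\<forall>H\<in>\<N>. compact_open_bisection G H"
      unfolding \<N>_def using F(2) compact_open_bisection_cut by blast
    show "\<forall>H. compact_open_bisection G H \<longrightarrow> (\<exists>n. \<forall>m\<ge>n. \<forall>a b. cut m 0 a b H \<in> \<N>)"
    proof (intro allI impI)
      fix H assume H: "compact_open_bisection G H"
      have HG: "H \<subseteq> elems G" using H by (rule compact_open_bisection_elems)
      have "compactin (gtop G) H" using H by (simp add: compact_open_bisection_def)
      from absorbing_invariant_compactin[OF D(2-4) this]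
      obtain n where n: "(\<zeta> ^^ n) ` H \<subseteq> D" .
      let ?H = "{cut n 0 a b H | a b. True}"
      have fin: "finite ?H" using HG by (rule finite_cuts)
      have cob: "\<forall>K\<in>?H. compact_open_bisection G K" using H compact_open_bisection_cut by blast
      have "cut n 0 a b H \<subseteq> \<Union>\<F>" for a b using n unfolding cut_def DF by blast
      then have "\<Union>?H \<subseteq> \<Union>\<F>" by blast
      from uniform_slice_finite[OF fin cob F(2) this] obtain k' where
        k': "\<forall>K\<in>?H. \<forall>l\<ge>k'. \<forall>c. slice l c K = {} \<or> (\<exists>F\<in>\<F>. slice l c K = slice l c F)" .
      \<comment> \<open>\<open>n\<close> steps lead into \<open>D\<close>; the remaining depth must
        reach both \<open>k'\<close>, for slices by the cover, and \<open>k\<close>, for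
        \<open>deep\<close>.\<close>
      have "cut m 0 a b H \<in> \<N>" if m: "n + k' + k \<le> m" for m a b
      proof -
        define p where "p = m - n"
        have p: "m = n + p" "k' \<le> p" "k \<le> p" using m by (auto simp: p_def)
        define a' b' where "a' = (shift ^^ n) a" and "b' = (shift ^^ n) b"
        have "cut m 0 a b H = cut p 0 a' b' (cut n p a b H)"
          using cut_cut[OF HG, of p p 0 n a b] by (simp add: a'_def b'_def p(1))
        moreover have "cut n p a b H = slice p a' (cut n 0 a b H)"
          using slice_cut[OF HG, of p n a 0 b] by (simp add: a'_def)
        moreover have "slice p a' (cut n 0 a b H) = {} \<or>
            (\<exists>F\<in>\<F>. slice p a' (cut n 0 a b H) = slice p a' F)"
          using k' p(2) by blast
        ultimately have eq: "cut m 0 a b H = cut p 0 a' b' {} \<or>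
            (\<exists>F\<in>\<F>. cut m 0 a b H = cut p 0 a' b' (slice p a' F))" by metis
        have "cut p 0 a' b' (slice p a' F) = cut p 0 a' b' F" for F
          by (rule cut_slice_absorb) simp
        then show ?thesis using eq deep[OF _ p(3)] \<open>{} \<in> \<N>\<close> by auto
      qed
      then show "\<exists>n. \<forall>m\<ge>n. \<forall>a b. cut m 0 a b H \<in> \<N>" by blast
    qed
  qed
qed

section \<open>Passage between the three conditions\<close>

lemma ex_bisection_nucleus:
  assumes "compactin (gtop G) C" "absorbing E G e C"
  shows "\<exists>\<N>. is_bisection_nucleus X E G e \<N>"
proof -
  obtain D where D: "compactin (gtop G) D" "openin (gtop G) D" "absorbing E G e D" "\<zeta> ` D \<subseteq> D"
    using ex_absorbing_invariant[OF assms] .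
  obtain \<N> where N: "finite \<N>" "{} \<in> \<N>" "\<forall>H\<in>\<N>. compact_open_bisection G H"
    "\<forall>H. compact_open_bisection G H \<longrightarrow> (\<exists>n. \<forall>m\<ge>n. \<forall>a b. cut m 0 a b H \<in> \<N>)"
    using finite_deep_cuts[OF D] .
  have "\<exists>n. \<forall>m\<ge>n. \<forall>v1\<in>words X m. \<forall>v2\<in>words X m.
      S_word E v2 O bis_map G e F O converse (S_word E v1) \<in> bis_map G e ` \<N>"
    if F: "compact_open_bisection G F" for F
  proof -
    obtain n where n: "\<forall>m\<ge>n. \<forall>a b. cut m 0 a b F \<in> \<N>" using N(4) F by blast
    have "S_word E v2 O bis_map G e F O converse (S_word E v1) \<in> bis_map G e ` \<N>"
      if "n \<le> m" "v1 \<in> words X m" "v2 \<in> words X m" for m v1 v2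
      using that n conj_words[OF compact_open_bisection_elems[OF F], of v1 m v2]
      by (simp add: words_def)
    then show ?thesis by blast
  qed
  then show ?thesis using N unfolding is_bisection_nucleus_def by blast
qed

text \<open>The images of \<open>D\<close> decrease and eventually are unions of members of a finite
  set, so two of them coincide. The earlier of the two is the nucleus.\<close>

lemma ex_nucleus:
  assumes "compactin (gtop G) C" "absorbing E G e C"
  shows "\<exists>N. is_nucleus E G e N"
proof -
  obtain D where D: "compactin (gtop G) D" "openin (gtop G) D" "absorbing E G e D" "\<zeta> ` D \<subseteq> D"
    using ex_absorbing_invariant[OF assms] .
  obtain \<N> where N: "finite \<N>" "{} \<in> \<N>" "\<forall>H\<in>\<N>. compact_open_bisection G H"
    "\<forall>H. compact_open_bisection G H \<longrightarrow> (\<exists>n. \<forall>m\<ge>n. \<forall>a b. cut m 0 a b H \<in> \<N>)"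
    using finite_deep_cuts[OF D] .
  obtain \<F> where F: "finite \<F>" "\<forall>F\<in>\<F>. compact_open_bisection G F" "D \<subseteq> \<Union>\<F>" "\<Union>\<F> \<subseteq> D"
    using compactin_cover[OF D(1,2) subset_refl] .
  have "\<forall>F\<in>\<F>. \<exists>n. \<forall>m\<ge>n. \<forall>a b. cut m 0 a b F \<in> \<N>" using F(2) N(4) by blast
  from bchoice[OF this]
  obtain n where n: "\<forall>F\<in>\<F>. \<forall>m\<ge>n F. \<forall>a b. cut m 0 a b F \<in> \<N>" ..
  obtain M where M: "\<forall>i\<in>n ` \<F>. i \<le> M"
    using finite_imageI[OF F(1)] finite_nat_set_iff_bounded_le by blast
  have "(\<zeta> ^^ m) ` D \<in> Union ` Pow \<N>" if m: "M \<le> m" for m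
  proof -
    let ?A = "{cut m 0 a b F | a b F. F \<in> \<F>}"
    have "(\<zeta> ^^ m) ` D = \<Union>?A"
    proof
      have "cut m 0 a b F \<subseteq> (\<zeta> ^^ m) ` D" if "F \<in> \<F>" for a b F
        using that F(4) unfolding cut_def by blast
      then show "\<Union>?A \<subseteq> (\<zeta> ^^ m) ` D" by blast
      show "(\<zeta> ^^ m) ` D \<subseteq> \<Union>?A"
      proof clarify
        fix d assume "d \<in> D"
        then obtain F where F: "F \<in> \<F>" "d \<in> F" using F(3) by blast
        \<comment> \<open>The endpoints of \<open>d\<close> themselves serve as the prescribed
          sequences.\<close>
        then have "(\<zeta> ^^ m) d \<in> cut m 0 (s d) (r d) F" by (auto simp: cut_def)
        then show "(\<zeta> ^^ m) d \<in> \<Union>?A" using F(1) by blast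
      qed
    qed
    moreover have "?A \<subseteq> \<N>"
    proof clarify
      fix a b F assume "F \<in> \<F>"
      then have "n F \<le> m" using M m by (meson imageI le_trans)
      then show "cut m 0 a b F \<in> \<N>" using n \<open>F \<in> \<F>\<close> by blast
    qed
    ultimately show ?thesis by blast
  qed
  then have "(\<lambda>m. (\<zeta> ^^ m) ` D) ` {M..} \<subseteq> Union ` Pow \<N>" by blast
  then have "finite ((\<lambda>m. (\<zeta> ^^ m) ` D) ` {M..})" using N(1) by (simp add: finite_subset)
  then have "\<not> inj_on (\<lambda>m. (\<zeta> ^^ m) ` D) {M..}" using finite_imageD infinite_Ici by blast
  then obtain i j where ij: "i < j" "(\<zeta> ^^ i) ` D = (\<zeta> ^^ j) ` D"
    unfolding inj_on_def by (metis linorder_neqE_nat)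
  let ?N = "(\<zeta> ^^ i) ` D"
  have "is_nucleus E G e ?N"
    unfolding is_nucleus_def
  proof (intro conjI)
    show "compactin (gtop G) ?N" by (rule compactin_varsigma_pow[OF D(1)])
    show "openin (gtop G) ?N" by (rule openin_varsigma_pow[OF D(2)])
    have S: "\<zeta> ` ?N = (\<zeta> ^^ Suc i) ` D" by (simp add: image_comp)
    show "\<zeta> ` ?N = ?N"
    proof
      show "\<zeta> ` ?N \<subseteq> ?N" unfolding S by (rule varsigma_pow_antimono[OF D(4)]) simp
      \<comment> \<open>\<open>Suc i \<le> j\<close> squeezes the next image between the two equal
        ones.\<close>
      have "(\<zeta> ^^ j) ` D \<subseteq> \<zeta> ` ?N"
        unfolding S using ij(1) by (intro varsigma_pow_antimono[OF D(4)]) simp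
      then show "?N \<subseteq> \<zeta> ` ?N" using ij(2) by simp
    qed
    show "absorbing E G e ?N"
      unfolding absorbing_def
    proof
      fix g assume "g \<in> elems G"
      then obtain p where "(\<zeta> ^^ p) g \<in> D" using D(3) by (auto simp: absorbing_def)
      then have "(\<zeta> ^^ (i + p)) g \<in> ?N" by (simp add: funpow_add)
      then show "\<exists>q. (\<zeta> ^^ q) g \<in> ?N" by blast
    qed
  qed
  then show ?thesis by blast
qed

text \<open>Any \<open>g\<close> lies in a compact open bisection; cutting it along the first
  \<open>m\<close> letters of the range and source of \<open>g\<close> leaves a member of
  \<open>\<N>\<close> containing \<open>(\<zeta> ^^ m) g\<close>.\<close>

lemma bisection_nucleus_imp_absorbing:
  assumes N: "is_bisection_nucleus X E G e \<N>"
  shows "compactin (gtop G) (\<Union>\<N>)" "absorbing E G e (\<Union>\<N>)"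
proof -
  have Nb: "finite \<N>" "\<forall>H\<in>\<N>. compact_open_bisection G H"
    using N by (auto simp: is_bisection_nucleus_def)
  then show "compactin (gtop G) (\<Union>\<N>)"
    by (intro compactin_Union) (auto simp: compact_open_bisection_def)
  show "absorbing E G e (\<Union>\<N>)"
    unfolding absorbing_def
  proof
    fix g assume g: "g \<in> elems G"
    obtain F where F: "compact_open_bisection G F" "g \<in> F"
      using ex_compact_open_bisection[OF openin_topspace g] .
    obtain m where m: "\<forall>v1\<in>words X m. \<forall>v2\<in>words X m.
        S_word E v2 O bis_map G e F O converse (S_word E v1) \<in> bis_map G e ` \<N>"
      using N F(1) unfolding is_bisection_nucleus_def by blast
    define u v where "u = map (s g) [0..<m]" and "v = map (r g) [0..<m]"
    have uv: "u \<in> words X m" "v \<in> words X m"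
      using s_in[OF g] r_in[OF g] by (auto simp: u_def v_def words_def topspace_E markov_chain_def)
    have len: "length v = m" "length u = m" by (simp_all add: u_def v_def)
    let ?K = "cut m 0 ((!) u) ((!) v) F"
    have "bis_map G e ?K \<in> bis_map G e ` \<N>"
      using m uv conj_words[OF compact_open_bisection_elems[OF F(1)] len] by metis
    then obtain H where H: "H \<in> \<N>" "bis_map G e ?K = bis_map G e H" by blast
    have "?K = H"
      using H Nb(2) compact_open_bisection_cut[OF F(1)]
      by (intro bis_map_inj) (auto simp: compact_open_bisection_iff)
    moreover have "(\<zeta> ^^ m) g \<in> ?K" using F(2) by (auto simp: cut_def u_def v_def)
    ultimately show "\<exists>n. (\<zeta> ^^ n) g \<in> \<Union>\<N>" using H(1) by blast
  qed
qed

text \<open>Some iterate carries the compact \<open>N\<close> into the invariant open set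
  \<open>N'\<close>, yet every iterate maps \<open>N\<close> onto itself; then exchange
  roles.\<close>

lemma nucleus_unique:
  assumes "is_nucleus E G e N" "is_nucleus E G e N'"
  shows "N = N'"
proof -
  have "N \<subseteq> N'" if N: "is_nucleus E G e N" and N': "is_nucleus E G e N'" for N N'
  proof -
    have "openin (gtop G) N'" "absorbing E G e N'" "\<zeta> ` N' \<subseteq> N'" "compactin (gtop G) N"
      using N N' by (auto simp: is_nucleus_def)
    from absorbing_invariant_compactin[OF this]
    obtain K where K: "(\<zeta> ^^ K) ` N \<subseteq> N'" .
    have "(\<zeta> ^^ n) ` N = N" for n
    proof (induction n)
      case (Suc n)
      have "(\<zeta> ^^ Suc n) ` N = \<zeta> ` (\<zeta> ^^ n) ` N" using varsigma_pow_image_add[of 1 n N] by simp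
      then show ?case using Suc N by (simp add: is_nucleus_def)
    qed simp
    then show ?thesis using K by blast
  qed
  then show ?thesis using assms by blast
qed

text \<open>
  The smallest set consists of the empty bisection and of the bisections that are cut out of some
  compact open bisection at infinitely many depths.
\<close>

lemma ex_smallest_bisection_nucleus:
  assumes N: "is_bisection_nucleus X E G e \<N>"
  shows "\<exists>\<M>. is_bisection_nucleus X E G e \<M> \<and>
    (\<forall>\<N>'. is_bisection_nucleus X E G e \<N>' \<longrightarrow> \<M> \<subseteq> \<N>')"
proof -
  \<comment> \<open>\<open>hit F m H\<close> records that \<open>H\<close> is cut out of
    \<open>F\<close> at depth \<open>m\<close>.\<close>
  define hit where "hit F m H \<longleftrightarrow> (\<exists>v1\<in>words X m. \<exists>v2\<in>words X m.
    S_word E v2 O bis_map G e F O converse (S_word E v1) = bis_map G e H)" for F m H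
  define \<M> where "\<M> = insert {} {H. compact_open_bisection G H \<and>
    (\<exists>F. compact_open_bisection G F \<and> (\<forall>n. \<exists>m\<ge>n. hit F m H))}"
  have sub: "\<M> \<subseteq> \<N>'" if N': "is_bisection_nucleus X E G e \<N>'" for \<N>'
  proof
    fix H assume "H \<in> \<M>"
    then consider "H = {}" | F where "compact_open_bisection G H" "compact_open_bisection G F"
      "\<forall>n. \<exists>m\<ge>n. hit F m H" by (auto simp: \<M>_def)
    then show "H \<in> \<N>'"
    proof cases
      case 1 then show ?thesis using N' by (simp add: is_bisection_nucleus_def)
    next
      case 2
      obtain n where n: "\<forall>m\<ge>n. \<forall>v1\<in>words X m. \<forall>v2\<in>words X m.
        S_word E v2 O bis_map G e F O converse (S_word E v1) \<in> bis_map G e ` \<N>'"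
        using N' 2(2) unfolding is_bisection_nucleus_def by blast
      obtain m where "n \<le> m" "hit F m H" using 2(3) by blast
      then have "bis_map G e H \<in> bis_map G e ` \<N>'" using n unfolding hit_def by metis
      then obtain K where K: "K \<in> \<N>'" "bis_map G e H = bis_map G e K" by blast
      then have "compact_open_bisection G K" using N' by (auto simp: is_bisection_nucleus_def)
      then have "H = K" using 2(1) K(2) bis_map_inj by (simp add: compact_open_bisection_iff)
      then show ?thesis using K(1) by simp
    qed
  qed
  have Nb: "finite \<N>" "\<forall>H\<in>\<N>. compact_open_bisection G H"
    using N by (auto simp: is_bisection_nucleus_def)
  have "\<exists>n. \<forall>m\<ge>n. \<forall>v1\<in>words X m. \<forall>v2\<in>words X m.
      S_word E v2 O bis_map G e F O converse (S_word E v1) \<in> bis_map G e ` \<M>"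
    if F: "compact_open_bisection G F" for F
  proof -
    obtain n where n: "\<forall>m\<ge>n. \<forall>v1\<in>words X m. \<forall>v2\<in>words X m.
        S_word E v2 O bis_map G e F O converse (S_word E v1) \<in> bis_map G e ` \<N>"
      using N F unfolding is_bisection_nucleus_def by blast
    \<comment> \<open>Members of \<open>\<N>\<close> left out of \<open>\<M>\<close> are hit by
      \<open>F\<close> at only finitely many depths, and since \<open>\<N>\<close> is finite one
      bound serves for all of them.\<close>
    have "\<forall>H\<in>\<N> - \<M>. \<exists>k. \<forall>m\<ge>k. \<not> hit F m H"
      using Nb(2) F unfolding \<M>_def by blast
    from bchoice[OF this] obtain k where k: "\<forall>H\<in>\<N> - \<M>. \<forall>m\<ge>k H. \<not> hit F m H" ..
    have "finite (k ` (\<N> - \<M>))" using Nb(1) by simp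
    then obtain K where K: "\<forall>i\<in>k ` (\<N> - \<M>). i \<le> K"
      using finite_nat_set_iff_bounded_le by blast
    have "S_word E v2 O bis_map G e F O converse (S_word E v1) \<in> bis_map G e ` \<M>"
      if m: "max n K \<le> m" and v: "v1 \<in> words X m" "v2 \<in> words X m" for m v1 v2
    proof -
      obtain H where H: "H \<in> \<N>"
        "S_word E v2 O bis_map G e F O converse (S_word E v1) = bis_map G e H"
        using n m v by (meson imageE max.bounded_iff)
      then have "hit F m H" using v unfolding hit_def by blast
      moreover have "k H \<le> m" if "H \<notin> \<M>"
        using K m H(1) that by (meson DiffI imageI le_trans max.bounded_iff)
      ultimately have "H \<in> \<M>" using k H(1) by blast
      then show ?thesis unfolding H(2) by (rule imageI)
    qed
    then show ?thesis by blast
  qed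
  moreover have MN: "\<M> \<subseteq> \<N>" using N by (rule sub)
  moreover have "finite \<M>" using MN Nb(1) by (rule finite_subset)
  moreover have "\<forall>H\<in>\<M>. compact_open_bisection G H" using MN Nb(2) by blast
  moreover have "{} \<in> \<M>" by (simp add: \<M>_def)
  ultimately have "is_bisection_nucleus X E G e \<M>"
    by (simp add: is_bisection_nucleus_def)
  then show ?thesis using sub by blast
qed

end

theorem theorem6p5:
  fixes X :: "'a set" and T :: "('a \<times> 'a) set"
    and E :: "(nat \<Rightarrow> 'a) topology"
    and G :: "'g groupoid_data" and e :: "'g \<Rightarrow> nat \<Rightarrow> 'a"
  assumes "finite X" and "T \<subseteq> X \<times> X" and "E = markov_space X T"
    and "shift_invariant_groupoid E G e"
  shows "((\<exists>C. compactin (gtop G) C \<and> absorbing E G e C) \<longleftrightarrow> (\<exists>N. is_nucleus E G e N))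
       \<and> ((\<exists>N. is_nucleus E G e N) \<longleftrightarrow> (\<exists>\<N>. is_bisection_nucleus X E G e \<N>))
       \<and> (\<forall>N N'. is_nucleus E G e N \<longrightarrow> is_nucleus E G e N' \<longrightarrow> N = N')
       \<and> ((\<exists>\<N>. is_bisection_nucleus X E G e \<N>) \<longrightarrow>
            (\<exists>\<N>. is_bisection_nucleus X E G e \<N> \<and>
                 (\<forall>\<N>'. is_bisection_nucleus X E G e \<N>' \<longrightarrow> \<N> \<subseteq> \<N>')))"
proof -
  interpret markov_groupoid E G e X T
    using assms by (simp add: markov_groupoid_def markov_groupoid_axioms_def)
  have 1: "(\<exists>C. compactin (gtop G) C \<and> absorbing E G e C) \<longleftrightarrow> (\<exists>N. is_nucleus E G e N)"
    using ex_nucleus unfolding is_nucleus_def by blast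
  \<comment> \<open>Condition (1) is the hub; the union of \<open>\<N>\<close> is the compact set
    for the converse.\<close>
  have 2: "(\<exists>C. compactin (gtop G) C \<and> absorbing E G e C) \<longleftrightarrow>
      (\<exists>\<N>. is_bisection_nucleus X E G e \<N>)"
    using ex_bisection_nucleus bisection_nucleus_imp_absorbing by blast
  show ?thesis
  proof (intro conjI)
    show "(\<exists>C. compactin (gtop G) C \<and> absorbing E G e C) \<longleftrightarrow> (\<exists>N. is_nucleus E G e N)"
      by (rule 1)
    \<comment> \<open>Substituting along \<open>1\<close> replaces condition (1) by condition (2) in
      \<open>2\<close>.\<close>
    show "(\<exists>N. is_nucleus E G e N) \<longleftrightarrow> (\<exists>\<N>. is_bisection_nucleus X E G e \<N>)"
      using 1 2 by (rule subst)
    show "\<forall>N N'. is_nucleus E G e N \<longrightarrow> is_nucleus E G e N' \<longrightarrow> N = N'"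
      by (intro allI impI nucleus_unique)
    show "(\<exists>\<N>. is_bisection_nucleus X E G e \<N>) \<longrightarrow>
            (\<exists>\<N>. is_bisection_nucleus X E G e \<N> \<and>
                 (\<forall>\<N>'. is_bisection_nucleus X E G e \<N>' \<longrightarrow> \<N> \<subseteq> \<N>'))"
      by (intro impI, elim exE, rule ex_smallest_bisection_nucleus)
  qed
qed

end
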